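(* In the setting below, the kernel of the linear map \[\partial_3:\{\text{solutions of }H_A(A\cdot v)\}\longrightarrow\{\text{solutions of }H_A(\beta)\},\qquad \psi\mapsto\partial\psi/\partial x_3,\] is spanned by $\{x^u: u \text{ is a fake exponent of } H_A(A\cdot v) \text{ (with respect to } w') \text{ with minimum negative support and } u_3=0\}$.
   Context: Setting: $A=(a_{ij})$ is a $d\times n$ integer matrix of rank $d$, $n-d=2$, columns in $\{1\}\times\mathbb{Z}^{d-1}$ spanning $\mathbb{Z}^d$; $I_A\subset\mathbb{C}[\partial_1,\dots,\partial_n]$ is generated by $\partial^u-\partial^{u'}$, $u,u'\in\mathbb{N}^n$, $Au=Au'$; $H_A(\beta')$ is the left ideal of the Weyl algebra generated by $I_A$ and $\sum_j a_{ij}x_j\partial_j-\beta'_i$; its solutions are (possibly logarithmic) holomorphic solutions on a common open set near a generic point. $B=(b_{ji})$ is $n\times2$ with columns $B_1,B_2$ a $\mathbb{Z}$-basis of $\ker_{\mathbb{Z}}(A)$, $b_{11},b_{12}>0$, $b_{21}<0<b_{22}$, $b_{31},b_{32}<0$, $b_{41}>0>b_{42}$, and if rows 2, 4 of $B$ are linearly independent then $\{z\in\mathbb{R}^2:(Bz)_2\ge0,(Bz)_4\ge0\}$ lies in the first quadrant. $\alpha_5,\dots,\alpha_n\in\mathbb{C}\setminus\mathbb{Q}$ with $\alpha_i\notin\mathbb{Q}(\alpha_j:j\ge5,j\ne i)$; $v=B_{1+}+B_{2+}-e_1-e_2-e_4+\sum_{i\ge5}\alpha_ie_i$, where $(u_+)_l=\max(u_l,0)$;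 $\beta=A(v-e_3)$. Weight: $w'=-e_3$ if $\operatorname{in}_{-e_3}(I_A)$ is a monomial ideal; otherwise $w'=-e_3+\epsilon w$ with $w\in\mathbb{R}^n$ and $\epsilon>0$ small such that $\operatorname{in}_{w'}(I_A)=\operatorname{in}_w(\operatorname{in}_{-e_3}(I_A))$ is monomial. A standard pair of a monomial ideal $M$ is a pair $(\partial^\eta,\sigma)$ with $\eta_i=0$ for $i\in\sigma$, $\partial^\eta\prod_{i\in\sigma}\partial_i^{\mu_i}\notin M$ for all $\mu$, and for each $l\notin\sigma$ some $\partial^\eta\partial_l^{\mu_l}\prod_{i\in\sigma}\partial_i^{\mu_i}\in M$. A fake exponent of $H_A(\beta')$ with respect to $w'$ is $u\in\mathbb{C}^n$ with $Au=\beta'$ and $u_i=\eta_i$ ($i\notin\sigma$) for a standard pair $(\partial^\eta,\sigma)$ of $\operatorname{in}_{w'}(I_A)$. $\operatorname{nsupp}(u)=\{i:u_i\in\mathbb{Z}_{<0}\}$; $u$ has minimum negative support if for every $v'\in\ker_{\mathbb{Z}}(A)$, $\operatorname{nsupp}(u+v')\subseteq\operatorname{nsupp}(u)$ implies equality. $x^u=\prod_i\exp(u_i\log x_i)$. *)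

theory Defs
  imports
    "HOL-Analysis.Analysis"
    "HOL-Library.Poly_Mapping"
    "HOL-Library.Function_Algebras"
begin

text \<open>
  Coordinates are indexed by finite types: \<open>'n\<close> for the columns of \<open>A\<close> (the variables)
  and \<open>'d\<close> for its rows. Multi-exponents are vectors in \<open>nat ^ 'n\<close>.
\<close>

subsection \<open>Commutative polynomials in the partial derivatives\<close>

type_synonym 'n dpoly = "(nat ^ 'n) \<Rightarrow>\<^sub>0 complex"

definition dmonom :: "nat ^ 'n \<Rightarrow> 'n::finite dpoly" where
  "dmonom u = Poly_Mapping.single u 1"

definition ideal_gen :: "'a::comm_ring_1 set \<Rightarrow> 'a set" where
  "ideal_gen S = module.span (*) S"

lemma module_ring_mult: "module ((*) :: 'a::comm_ring_1 \<Rightarrow> 'a \<Rightarrow> 'a)"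
  by unfold_locales (simp_all add: algebra_simps)

definition toric_ideal :: "int ^ 'n ^ 'd \<Rightarrow> 'n::finite dpoly set" where
  "toric_ideal A = ideal_gen {dmonom u - dmonom u' | u u'.
     A *v (\<chi> j. int (u $ j)) = A *v (\<chi> j. int (u' $ j))}"

definition wt :: "real ^ 'n \<Rightarrow> nat ^ 'n \<Rightarrow> real" where
  "wt w u = (\<Sum>j\<in>UNIV. w $ j * real (u $ j))"

text \<open>Initial forms collect the terms of \<^emph>\<open>maximal\<close> weight.\<close>

definition initial_form :: "real ^ 'n \<Rightarrow> 'n::finite dpoly \<Rightarrow> 'n dpoly" where
  "initial_form w f =
     (\<Sum>u \<in> {u \<in> Poly_Mapping.keys f. \<forall>u' \<in> Poly_Mapping.keys f. wt w u' \<le> wt w u}.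
        Poly_Mapping.single u (Poly_Mapping.lookup f u))"

definition initial_ideal :: "real ^ 'n \<Rightarrow> 'n::finite dpoly set \<Rightarrow> 'n dpoly set" where
  "initial_ideal w I = ideal_gen (initial_form w ` I)"

definition monomial_ideal :: "'n::finite dpoly set \<Rightarrow> bool" where
  "monomial_ideal M \<longleftrightarrow> (\<exists>S. M = ideal_gen (dmonom ` S))"

text \<open>The weights \<open>w'\<close> attached to the index \<open>i\<close>: either \<open>- e\<^sub>i\<close> or a perturbation of it.
  The equation between initial ideals holds for all sufficiently small \<open>\<epsilon> > 0\<close>, and the
  results depend on \<open>w'\<close> only through the initial ideal.\<close>

definition admissible_weight :: "int ^ 'n ^ 'd \<Rightarrow> 'n::finite \<Rightarrow> real ^ 'n \<Rightarrow> bool" where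
  "admissible_weight A i w' \<longleftrightarrow>
     (let J = initial_ideal (- axis i 1) (toric_ideal A) in
      if monomial_ideal J then w' = - axis i 1
      else \<exists>w \<epsilon>. \<epsilon> > 0 \<and> w' = - axis i 1 + \<epsilon> *\<^sub>R w
             \<and> initial_ideal w' (toric_ideal A) = initial_ideal w J
             \<and> monomial_ideal (initial_ideal w' (toric_ideal A)))"

definition standard_pair :: "'n::finite dpoly set \<Rightarrow> nat ^ 'n \<Rightarrow> 'n set \<Rightarrow> bool" where
  "standard_pair M \<eta> \<sigma> \<longleftrightarrow>
     (\<forall>i\<in>\<sigma>. \<eta> $ i = 0) \<and>
     (\<forall>\<mu>. (\<forall>i. i \<notin> \<sigma> \<longrightarrow> \<mu> $ i = 0) \<longrightarrow> dmonom (\<eta> + \<mu>) \<notin> M) \<and>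
     (\<forall>l. l \<notin> \<sigma> \<longrightarrow>
        (\<exists>\<mu>. (\<forall>i. i \<notin> insert l \<sigma> \<longrightarrow> \<mu> $ i = 0) \<and> dmonom (\<eta> + \<mu>) \<in> M))"

subsection \<open>Exponents\<close>

definition complex_vec :: "int ^ 'n \<Rightarrow> complex ^ 'n" where
  "complex_vec u = (\<chi> j. of_int (u $ j))"

definition complex_mat :: "int ^ 'n ^ 'd \<Rightarrow> complex ^ 'n::finite ^ 'd::finite" where
  "complex_mat A = map_matrix of_int A"

definition real_mat :: "int ^ 'n ^ 'd \<Rightarrow> real ^ 'n::finite ^ 'd::finite" where
  "real_mat A = map_matrix of_int A"

definition pos_part :: "int ^ 'n \<Rightarrow> int ^ 'n" where
  "pos_part u = (\<chi> j. max (u $ j) 0)"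

definition fake_exponent ::
  "int ^ 'n ^ 'd \<Rightarrow> complex ^ 'd \<Rightarrow> real ^ 'n \<Rightarrow> complex ^ 'n::finite \<Rightarrow> bool" where
  "fake_exponent A \<beta> w u \<longleftrightarrow>
     complex_mat A *v u = \<beta> \<and>
     (\<exists>\<eta> \<sigma>. standard_pair (initial_ideal w (toric_ideal A)) \<eta> \<sigma> \<and>
            (\<forall>i. i \<notin> \<sigma> \<longrightarrow> u $ i = of_nat (\<eta> $ i)))"

definition nsupp :: "complex ^ 'n \<Rightarrow> 'n set" where
  "nsupp u = {i. \<exists>k::int. k < 0 \<and> u $ i = of_int k}"

definition min_neg_support :: "int ^ 'n ^ 'd \<Rightarrow> complex ^ 'n::finite \<Rightarrow> bool" where
  "min_neg_support A u \<longleftrightarrow>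
     (\<forall>v'. A *v v' = 0 \<longrightarrow> nsupp (u + complex_vec v') \<subseteq> nsupp u \<longrightarrow>
           nsupp (u + complex_vec v') = nsupp u)"

text \<open>The subfield of \<open>\<complex>\<close> generated by \<open>S\<close>, that is, \<open>\<rat>(S)\<close>: every subfield contains \<open>\<rat>\<close>.\<close>

definition complex_subfield :: "complex set \<Rightarrow> bool" where
  "complex_subfield F \<longleftrightarrow> 0 \<in> F \<and> 1 \<in> F \<and>
     (\<forall>x\<in>F. \<forall>y\<in>F. x - y \<in> F \<and> x * y \<in> F) \<and> (\<forall>x\<in>F. inverse x \<in> F)"

definition rat_adjoin :: "complex set \<Rightarrow> complex set" where
  "rat_adjoin S = \<Inter>{F. complex_subfield F \<and> S \<subseteq> F}"

subsection \<open>The Weyl algebra\<close>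

text \<open>
  Elements of the Weyl algebra in normally ordered form: the key \<open>(a, b)\<close> stands for the
  operator \<open>x\<^sup>a \<partial>\<^sup>b\<close>. The commutative product that the type inherits from
  \<^typ>\<open>'a \<Rightarrow>\<^sub>0 'b\<close> is not the product of the Weyl algebra and is not used. Left multiplication
  by the algebra generators \<open>x\<^sub>i\<close> and \<open>\<partial>\<^sub>i\<close> is given by
  \<open>x\<^sub>i (x\<^sup>a \<partial>\<^sup>b) = x\<^sup>a\<^sup>+\<^sup>e\<^sup>i \<partial>\<^sup>b\<close> and
  \<open>\<partial>\<^sub>i (x\<^sup>a \<partial>\<^sup>b) = x\<^sup>a \<partial>\<^sup>b\<^sup>+\<^sup>e\<^sup>i + a\<^sub>i x\<^sup>a\<^sup>-\<^sup>e\<^sup>i \<partial>\<^sup>b\<close>.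
\<close>

type_synonym 'n weyl = "(nat ^ 'n) \<times> (nat ^ 'n) \<Rightarrow>\<^sub>0 complex"

definition weyl_x :: "'n \<Rightarrow> 'n::finite weyl \<Rightarrow> 'n weyl" where
  "weyl_x i P = (\<Sum>(a, b) \<in> Poly_Mapping.keys P.
     Poly_Mapping.single (a + axis i 1, b) (Poly_Mapping.lookup P (a, b)))"

definition weyl_d :: "'n \<Rightarrow> 'n::finite weyl \<Rightarrow> 'n weyl" where
  "weyl_d i P = (\<Sum>(a, b) \<in> Poly_Mapping.keys P.
     Poly_Mapping.single (a, b + axis i 1) (Poly_Mapping.lookup P (a, b)) +
     Poly_Mapping.single (a - axis i 1, b) (of_nat (a $ i) * Poly_Mapping.lookup P (a, b)))"

text \<open>Since the scalars, the \<open>x\<^sub>i\<close> and the \<open>\<partial>\<^sub>i\<close> generate the Weyl algebra, a left ideal is a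
  linear subspace that is stable under left multiplication by the \<open>x\<^sub>i\<close> and \<open>\<partial>\<^sub>i\<close>.\<close>

inductive_set weyl_left_ideal :: "'n::finite weyl set \<Rightarrow> 'n weyl set" for G where
  zero: "0 \<in> weyl_left_ideal G"
| gen: "P \<in> G \<Longrightarrow> P \<in> weyl_left_ideal G"
| add: "P \<in> weyl_left_ideal G \<Longrightarrow> Q \<in> weyl_left_ideal G \<Longrightarrow> P + Q \<in> weyl_left_ideal G"
| scale: "P \<in> weyl_left_ideal G \<Longrightarrow> Poly_Mapping.map ((*) c) P \<in> weyl_left_ideal G"
| mult_x: "P \<in> weyl_left_ideal G \<Longrightarrow> weyl_x i P \<in> weyl_left_ideal G"
| mult_d: "P \<in> weyl_left_ideal G \<Longrightarrow> weyl_d i P \<in> weyl_left_ideal G"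

definition weyl_of_dpoly :: "'n::finite dpoly \<Rightarrow> 'n weyl" where
  "weyl_of_dpoly p = (\<Sum>b \<in> Poly_Mapping.keys p.
     Poly_Mapping.single (0, b) (Poly_Mapping.lookup p b))"

definition euler_op :: "int ^ 'n ^ 'd \<Rightarrow> complex ^ 'd \<Rightarrow> 'd \<Rightarrow> 'n::finite weyl" where
  "euler_op A \<beta> i =
     (\<Sum>j\<in>UNIV. Poly_Mapping.single (axis j 1, axis j 1) (of_int (A $ i $ j)))
       - Poly_Mapping.single (0, 0) (\<beta> $ i)"

definition hypergeometric_ideal ::
  "int ^ 'n ^ 'd \<Rightarrow> complex ^ 'd \<Rightarrow> 'n::finite weyl set" where
  "hypergeometric_ideal A \<beta> =
     weyl_left_ideal (weyl_of_dpoly ` toric_ideal A \<union> range (euler_op A \<beta>))"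

subsection \<open>Holomorphic functions of several variables and solutions\<close>

definition holomorphic_sev_on :: "(complex ^ 'n \<Rightarrow> complex) \<Rightarrow> (complex ^ 'n::finite) set \<Rightarrow> bool"
  where "holomorphic_sev_on f U \<longleftrightarrow>
     (\<forall>x\<in>U. \<exists>f'. (f has_derivative f') (at x) \<and> (\<forall>c h. f' (c *s h) = c * f' h))"

definition cpartial :: "'n \<Rightarrow> (complex ^ 'n \<Rightarrow> complex) \<Rightarrow> complex ^ 'n::finite \<Rightarrow> complex" where
  "cpartial i f x = deriv (\<lambda>t. f (x + axis i t)) 0"

text \<open>The order in which the partial derivatives are taken is immaterial for holomorphic
  functions.\<close>

definition multi_cpartial ::
  "nat ^ 'n \<Rightarrow> (complex ^ 'n \<Rightarrow> complex) \<Rightarrow> complex ^ 'n::finite \<Rightarrow> complex" where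
  "multi_cpartial b f = foldr cpartial (SOME is. \<forall>i. count_list is i = b $ i) f"

definition weyl_apply ::
  "'n weyl \<Rightarrow> (complex ^ 'n \<Rightarrow> complex) \<Rightarrow> complex ^ 'n::finite \<Rightarrow> complex" where
  "weyl_apply P f x = (\<Sum>(a, b) \<in> Poly_Mapping.keys P.
     Poly_Mapping.lookup P (a, b) * (\<Prod>j\<in>UNIV. x $ j ^ (a $ j)) * multi_cpartial b f x)"

text \<open>Functions on the open set \<open>U\<close> are represented by total functions that vanish outside \<open>U\<close>,
  so that equality of representatives is equality on \<open>U\<close>.\<close>

definition solutions ::
  "(complex ^ 'n) set \<Rightarrow> 'n weyl set \<Rightarrow> (complex ^ 'n::finite \<Rightarrow> complex) set" where
  "solutions U H = {f. holomorphic_sev_on f U \<and> (\<forall>x. x \<notin> U \<longrightarrow> f x = 0) \<and>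
     (\<forall>P\<in>H. \<forall>x\<in>U. weyl_apply P f x = 0)}"

definition cpartial_on ::
  "(complex ^ 'n) set \<Rightarrow> 'n \<Rightarrow> (complex ^ 'n \<Rightarrow> complex) \<Rightarrow> complex ^ 'n::finite \<Rightarrow> complex" where
  "cpartial_on U i f = (\<lambda>x. if x \<in> U then cpartial i f x else 0)"

text \<open>\<open>L i\<close> is the chosen branch of \<open>log x\<^sub>i\<close> on \<open>U\<close>.\<close>

definition log_branches :: "(complex ^ 'n::finite) set \<Rightarrow> ('n \<Rightarrow> complex ^ 'n \<Rightarrow> complex) \<Rightarrow> bool" where
  "log_branches U L \<longleftrightarrow> (\<forall>i. continuous_on U (L i) \<and> (\<forall>x\<in>U. exp (L i x) = x $ i))"

definition cmonomial_on ::
  "(complex ^ 'n) set \<Rightarrow> ('n \<Rightarrow> complex ^ 'n \<Rightarrow> complex) \<Rightarrow> complex ^ 'n \<Rightarrow>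
   complex ^ 'n::finite \<Rightarrow> complex" where
  "cmonomial_on U L u = (\<lambda>x. if x \<in> U then \<Prod>i\<in>UNIV. exp (u $ i * L i x) else 0)"

definition fun_scale :: "complex \<Rightarrow> ('a \<Rightarrow> complex) \<Rightarrow> 'a \<Rightarrow> complex" where
  "fun_scale c f = (\<lambda>x. c * f x)"

lemma module_fun_scale: "module fun_scale"
  by unfold_locales (auto simp: fun_scale_def fun_eq_iff algebra_simps)

definition fun_span :: "('a \<Rightarrow> complex) set \<Rightarrow> ('a \<Rightarrow> complex) set" where
  "fun_span = module.span fun_scale"

definition linear_map_between ::
  "('a \<Rightarrow> complex) set \<Rightarrow> ('a \<Rightarrow> complex) set \<Rightarrow>
   (('a \<Rightarrow> complex) \<Rightarrow> 'a \<Rightarrow> complex) \<Rightarrow> bool" where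
  "linear_map_between X Y T \<longleftrightarrow> T ` X \<subseteq> Y \<and>
     (\<forall>f\<in>X. \<forall>g\<in>X. T (f + g) = T f + T g) \<and>
     (\<forall>c. \<forall>f\<in>X. T (fun_scale c f) = fun_scale c (T f))"

end

theory Submission
  imports
    Defs
    "HOL-Complex_Analysis.Cauchy_Integral_Formula"
    "HOL-Computational_Algebra.Fundamental_Theorem_Algebra"
begin

text \<open>
  Let \<open>m\<close> span the part of the kernel of \<open>A\<close> with vanishing coordinate \<open>i3\<close>. By the Euler
  equations, a solution \<open>\<psi>\<close> with \<open>\<partial>\<^sub>3 \<psi> = 0\<close> is \<open>x\<^sup>v\<close> times a function of the single quantity
  \<open>x\<^sup>m\<close>. If \<open>y\<close> is an integer kernel vector with \<open>y\<^sub>3 < 0\<close>, its binomial shows that the positive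
  part of \<open>y\<close> annihilates \<open>\<psi>\<close>; this is a differential equation with constant coefficients in
  \<open>log x\<^sup>m\<close> whose characteristic polynomial is nonzero at \<open>t\<close> as soon as \<open>y\<^sub>j \<le> u\<^sub>j\<close> for all
  coordinates \<open>u\<^sub>j\<close> of \<open>u = v + t m\<close> in \<open>\<nat>\<close>.

  For \<open>t \<noteq> 0\<close> such a \<open>y\<close>, called a descent from \<open>u\<close>, always exists. If \<open>t\<close> is irrational, the
  genericity of \<open>\<alpha>\<close> leaves at most one natural coordinate outside the first four to control. If
  \<open>t\<close> is rational and \<open>\<mu>\<close> denotes the vector with \<open>B\<mu> = tm\<close>, some point of \<open>\<int>\<^sup>2\<close> lies in
  \<open>\<mu> + [0, 1)\<^sup>2\<close>, and the choice of \<open>v\<close> makes every noncorner point of this square admissible; if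
  \<open>\<mu>\<close> itself is integral, one of the two adjacent corners is admissible. At \<open>t = 0\<close> the polynomial
  of the first column of \<open>B\<close> has a simple root. Hence the kernel is spanned by \<open>x\<^sup>v\<close>, or is zero
  if there is a descent from \<open>v\<close>.

  On the algebraic side, a fake exponent admits no descent. Conversely, if \<open>v\<close> admits none, then
  every nonzero kernel vector exceeds \<open>v\<close> in some natural coordinate, so that the monomials that
  witness \<open>v\<close> as a fake exponent are alone in their fibres under \<open>A\<close> and lie in no initial ideal
  of \<open>I\<^sub>A\<close>.
\<close>

section \<open>Holomorphic functions of several variables\<close>

lemma norm_axis: "norm (axis i (t::complex)) = norm t"
proof -
  have "norm (axis i t) ^ 2 = norm t ^ 2"
    by (simp add: power2_norm_eq_inner inner_axis_axis)
  then show ?thesis by simp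
qed

lemma bounded_linear_axis: "bounded_linear (axis i :: complex \<Rightarrow> complex ^ 'n::finite)"
  by (rule bounded_linear_intro[where K = 1])
    (simp_all add: norm_axis, simp_all add: axis_def vec_eq_iff)

lemma sum_axis_mult: "(\<Sum>j\<in>UNIV. axis i t $ j * c j) = (t * c i :: 'a::semiring_0)"
  by (simp add: axis_def if_distrib[of "\<lambda>y. y * _"] cong: if_cong)

definition has_cgradient ::
  "(complex ^ 'n::finite \<Rightarrow> complex) \<Rightarrow> ('n \<Rightarrow> complex) \<Rightarrow> complex ^ 'n \<Rightarrow> bool" where
  "has_cgradient f c x \<longleftrightarrow> (f has_derivative (\<lambda>h. \<Sum>j\<in>UNIV. h $ j * c j)) (at x)"

lemma
  assumes "has_cgradient f c x"
  shows has_cgradient_imp_DERIV: "((\<lambda>t. f (x + axis i t)) has_field_derivative c i) (at 0)"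
    and has_cgradient_imp_cpartial: "cpartial i f x = c i"
proof -
  have "((\<lambda>t. x + axis i t) has_derivative (\<lambda>t. axis i t)) (at (0::complex))"
    using bounded_linear_axis[of i]
    by (auto intro!: derivative_eq_intros bounded_linear_imp_has_derivative)
  moreover have "(f has_derivative (\<lambda>h. \<Sum>j\<in>UNIV. h $ j * c j)) (at (x + axis i 0))"
    using assms by (simp add: has_cgradient_def axis_eq_0_iff[THEN iffD2])
  ultimately have "((\<lambda>t. f (x + axis i t)) has_derivative
      (\<lambda>t. \<Sum>j\<in>UNIV. axis i t $ j * c j)) (at 0)"
    by (rule has_derivative_compose)
  then show "((\<lambda>t. f (x + axis i t)) has_field_derivative c i) (at 0)"
    by (simp add: has_field_derivative_def sum_axis_mult mult_commute_abs)
  then show "cpartial i f x = c i"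
    unfolding cpartial_def by (rule DERIV_imp_deriv)
qed

lemma has_cgradient_unique: "has_cgradient f c x \<Longrightarrow> has_cgradient f c' x \<Longrightarrow> c = c'"
  using has_cgradient_imp_cpartial by (metis ext)

lemma has_cgradient_if_complex_linear:
  assumes "(f has_derivative f') (at x)" and complex_linear: "\<And>c h. f' (c *s h) = c * f' h"
  shows "has_cgradient f (\<lambda>j. f' (axis j 1)) x"
proof -
  have "f' h = (\<Sum>j\<in>UNIV. h $ j * f' (axis j 1))" for h
  proof -
    have "f' h = f' (\<Sum>j\<in>UNIV. h $ j *s axis j 1)" by (simp add: basis_expansion)
    also have "\<dots> = (\<Sum>j\<in>UNIV. f' (h $ j *s axis j 1))"
      using assms(1) has_derivative_linear linear_sum by blast
    finally show ?thesis by (simp add: complex_linear)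
  qed
  then show ?thesis using assms(1) unfolding has_cgradient_def by (metis (no_types, lifting) ext)
qed

lemma holomorphic_sev_onI:
  assumes "\<And>x. x \<in> U \<Longrightarrow> has_cgradient f (c x) x"
  shows "holomorphic_sev_on f U"
  unfolding holomorphic_sev_on_def
proof
  fix x assume "x \<in> U"
  then have "(f has_derivative (\<lambda>h. \<Sum>j\<in>UNIV. h $ j * c x j)) (at x)"
    using assms has_cgradient_def by blast
  then show "\<exists>f'. (f has_derivative f') (at x) \<and> (\<forall>c h. f' (c *s h) = c * f' h)"
    by (intro exI[of _ "\<lambda>h. \<Sum>j\<in>UNIV. h $ j * c x j"]) (auto simp: sum_distrib_left mult.assoc)
qed

lemma holomorphic_sev_on_imp_has_cgradient:
  assumes "holomorphic_sev_on f U" "x \<in> U"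
  shows "has_cgradient f (\<lambda>j. cpartial j f x) x"
proof -
  obtain f' where "(f has_derivative f') (at x)" "\<And>c h. f' (c *s h) = c * f' h"
    using assms unfolding holomorphic_sev_on_def by blast
  from has_cgradient_if_complex_linear[OF this] show ?thesis
    using has_cgradient_imp_cpartial[of f _ x] by simp
qed

lemma holomorphic_sev_on_imp_continuous_on: "holomorphic_sev_on f U \<Longrightarrow> continuous_on U f"
  unfolding holomorphic_sev_on_def
  by (auto intro!: continuous_at_imp_continuous_on dest!: bspec has_derivative_continuous)

lemma has_cgradient_cong:
  assumes "open U" "x \<in> U" "\<And>y. y \<in> U \<Longrightarrow> f y = g y"
  shows "has_cgradient f c x \<longleftrightarrow> has_cgradient g c x"
  unfolding has_cgradient_def
  using assms has_derivative_transform_within_open[of f _ x UNIV U g]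
    has_derivative_transform_within_open[of g _ x UNIV U f] by auto

lemma holomorphic_sev_on_cong:
  assumes "open U" "\<And>y. y \<in> U \<Longrightarrow> f y = g y" "holomorphic_sev_on f U"
  shows "holomorphic_sev_on g U"
  using holomorphic_sev_onI[of U g "\<lambda>x j. cpartial j f x"] has_cgradient_cong[of U _ f g]
    holomorphic_sev_on_imp_has_cgradient assms by blast

lemma cpartial_cong:
  assumes "open U" "x \<in> U" "\<And>y. y \<in> U \<Longrightarrow> f y = g y" "holomorphic_sev_on f U"
  shows "cpartial i f x = cpartial i g x"
  using has_cgradient_imp_cpartial[of g _ x i] has_cgradient_cong[of U x f g]
    holomorphic_sev_on_imp_has_cgradient assms by metis

lemma has_cgradient_const: "has_cgradient (\<lambda>y. a) (\<lambda>j. 0) x"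
  unfolding has_cgradient_def by simp

lemma has_cgradient_nth: "has_cgradient (\<lambda>y. y $ i) (\<lambda>j. if j = i then 1 else 0) x"
proof -
  have "((\<lambda>y. y $ i) has_derivative (\<lambda>h. h $ i)) (at x)"
    by (rule bounded_linear_imp_has_derivative) (rule bounded_linear_vec_nth)
  then show ?thesis
    by (simp add: has_cgradient_def if_distrib[of "\<lambda>z. _ * z"] cong: if_cong)
qed

lemma has_cgradient_add:
  "has_cgradient f c x \<Longrightarrow> has_cgradient g d x \<Longrightarrow>
    has_cgradient (\<lambda>y. f y + g y) (\<lambda>j. c j + d j) x"
  unfolding has_cgradient_def
  by (auto intro!: derivative_eq_intros simp: sum.distrib algebra_simps)

lemma has_cgradient_mult:
  "has_cgradient f c x \<Longrightarrow> has_cgradient g d x \<Longrightarrow>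
    has_cgradient (\<lambda>y. f y * g y) (\<lambda>j. f x * d j + c j * g x) x"
  unfolding has_cgradient_def
  by (auto intro!: derivative_eq_intros
      simp: sum.distrib sum_distrib_left sum_distrib_right algebra_simps)

lemma has_cgradient_cmult:
  "has_cgradient f c x \<Longrightarrow> has_cgradient (\<lambda>y. a * f y) (\<lambda>j. a * c j) x"
  using has_cgradient_mult[OF has_cgradient_const, of f c x a] by simp

lemma has_cgradient_sum:
  assumes "\<And>k. k \<in> K \<Longrightarrow> has_cgradient (f k) (c k) x"
  shows "has_cgradient (\<lambda>y. \<Sum>k\<in>K. f k y) (\<lambda>j. \<Sum>k\<in>K. c k j) x"
  using assms
  by (induction K rule: infinite_finite_induct)
    (auto intro!: has_cgradient_add simp: has_cgradient_const)

lemma has_cgradient_compose: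
  assumes "has_cgradient f c x" "(g has_field_derivative g') (at (f x))"
  shows "has_cgradient (\<lambda>y. g (f y)) (\<lambda>j. g' * c j) x"
proof -
  have "((\<lambda>y. g (f y)) has_derivative (\<lambda>h. g' * (\<Sum>j\<in>UNIV. h $ j * c j))) (at x)"
    using has_derivative_compose[of f _ x UNIV g "(*) g'"] assms
    unfolding has_cgradient_def has_field_derivative_def by blast
  then show ?thesis
    by (simp add: has_cgradient_def sum_distrib_left mult.left_commute)
qed

lemma has_cgradient_translate:
  assumes "has_cgradient f c (x + a)"
  shows "has_cgradient (\<lambda>y. f (y + a)) c x"
proof -
  have "((\<lambda>y. y + a) has_derivative (\<lambda>h. h)) (at x)"
    by (auto intro!: derivative_eq_intros)
  then show ?thesis
    using assms unfolding has_cgradient_def by (rule has_derivative_compose)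
qed

lemma
  assumes "holomorphic_sev_on f U" "holomorphic_sev_on g U"
  shows holomorphic_sev_on_lincomb: "holomorphic_sev_on (\<lambda>y. a * f y + b * g y) U"
    and cpartial_lincomb:
      "x \<in> U \<Longrightarrow> cpartial i (\<lambda>y. a * f y + b * g y) x = a * cpartial i f x + b * cpartial i g x"
proof -
  have grad: "has_cgradient (\<lambda>y. a * f y + b * g y) (\<lambda>i. a * cpartial i f x + b * cpartial i g x) x"
    if "x \<in> U" for x
    by (intro has_cgradient_add has_cgradient_cmult
        holomorphic_sev_on_imp_has_cgradient[OF _ that] assms)
  show "holomorphic_sev_on (\<lambda>y. a * f y + b * g y) U"
    using grad by (rule holomorphic_sev_onI)
  show "cpartial i (\<lambda>y. a * f y + b * g y) x = a * cpartial i f x + b * cpartial i g x" if "x \<in> U"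
    by (rule has_cgradient_imp_cpartial[OF grad[OF that]])
qed

lemma holomorphic_sev_on_const: "holomorphic_sev_on (\<lambda>_. a) U"
  by (rule holomorphic_sev_onI) (rule has_cgradient_const)

lemma cpartial_const: "cpartial i (\<lambda>_. a) x = 0"
  by (rule has_cgradient_imp_cpartial) (rule has_cgradient_const)

subsection \<open>Partial derivatives of holomorphic functions\<close>

lemma holomorphic_on_coordinate_line:
  assumes f: "holomorphic_sev_on f U" and line: "\<And>t. t \<in> T \<Longrightarrow> x + axis i t \<in> U"
  shows "(\<lambda>t. f (x + axis i t)) holomorphic_on T"
  unfolding holomorphic_on_def field_differentiable_def
proof
  fix t assume "t \<in> T"
  from holomorphic_sev_on_imp_has_cgradient[OF f line[OF this]]
  have "((\<lambda>s. f (x + axis i t + axis i s)) has_field_derivative cpartial i f (x + axis i t)) (at 0)"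
    by (rule has_cgradient_imp_DERIV)
  moreover have "x + axis i t + axis i s = x + axis i (s + t)" for s
    by (simp add: vec_eq_iff axis_def)
  ultimately have "((\<lambda>t. f (x + axis i t)) has_field_derivative cpartial i f (x + axis i t)) (at t)"
    using DERIV_shift[of "\<lambda>t. f (x + axis i t)" "cpartial i f (x + axis i t)" 0 t] by simp
  then show "\<exists>f'. ((\<lambda>t. f (x + axis i t)) has_field_derivative f') (at t within T)"
    by (blast intro: has_field_derivative_at_within)
qed

lemma cpartial_eq_circle_integral:
  assumes f: "holomorphic_sev_on f U" and r: "r > 0"
    and circle: "\<And>t. t \<in> cball 0 r \<Longrightarrow> x + axis i t \<in> U"
  shows "cpartial i f x =
    integral {0..1} (\<lambda>t. f (x + axis i (circlepath 0 r t)) * inverse (circlepath 0 r t))"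
proof -
  let ?F = "\<lambda>t. f (x + axis i t)"
  have "?F holomorphic_on cball 0 r"
    by (rule holomorphic_on_coordinate_line[OF f circle])
  then have "2 * pi * \<i> * cpartial i f x = contour_integral (circlepath 0 r) (\<lambda>u. ?F u / u\<^sup>2)"
    using Cauchy_contour_integral_circlepath_2[of 0 r ?F 0] r
      holomorphic_on_imp_continuous_on holomorphic_on_subset[OF _ ball_subset_cball]
    by (simp add: cpartial_def)
  also have "\<dots> = integral {0..1}
      (\<lambda>t. (2 * pi * \<i>) * (?F (circlepath 0 r t) * inverse (circlepath 0 r t)))"
    unfolding contour_integral_integral vector_derivative_circlepath
    using r by (intro arg_cong[of _ _ "integral {0..1}"] ext)
      (simp add: circlepath power2_eq_square field_simps)
  finally show ?thesis by (simp add: pi_neq_zero)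
qed

lemma continuous_on_translate_integrand:
  fixes f :: "'a::real_normed_vector \<Rightarrow> 'b::real_normed_algebra"
  assumes "continuous_on U f" "continuous_on T \<gamma>" "continuous_on T \<phi>"
    and "\<And>x t. x \<in> V \<Longrightarrow> t \<in> T \<Longrightarrow> x + \<gamma> t \<in> U"
  shows "continuous_on (V \<times> T) (\<lambda>(x, t). f (x + \<gamma> t) * \<phi> t)"
  unfolding case_prod_unfold
  by (intro continuous_on_mult continuous_on_compose2[OF assms(1)] continuous_on_add
      continuous_on_compose2[OF assms(2)] continuous_on_compose2[OF assms(3)] continuous_intros)
    (use assms(4) in auto)

definition linear_form :: "('n::finite \<Rightarrow> complex) \<Rightarrow> (complex ^ 'n) \<Rightarrow>\<^sub>L complex" where
  "linear_form c = Blinfun (\<lambda>h. \<Sum>j\<in>UNIV. h $ j * c j)"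

lemma blinfun_apply_linear_form: "blinfun_apply (linear_form c) = (\<lambda>h. \<Sum>j\<in>UNIV. h $ j * c j)"
  unfolding linear_form_def
  by (intro bounded_linear_Blinfun_apply bounded_linear_sum bounded_linear_mult_left
      bounded_linear_compose[OF bounded_linear_mult_left] bounded_linear_vec_nth)

lemma has_cgradient_iff_linear_form:
  "has_cgradient f c x \<longleftrightarrow> (f has_derivative blinfun_apply (linear_form c)) (at x)"
  by (simp add: has_cgradient_def blinfun_apply_linear_form)

lemma continuous_on_linear_form:
  fixes c :: "'a::t2_space \<Rightarrow> 'n::finite \<Rightarrow> complex"
  assumes "\<And>j. continuous_on S (\<lambda>z. c z j)"
  shows "continuous_on S (\<lambda>z. linear_form (c z))"
  by (rule continuous_on_blinfun_componentwise)
    (auto simp: blinfun_apply_linear_form intro!: continuous_on_sum continuous_on_mult_left assms)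

lemma integral_linear_form:
  fixes a b :: real
  assumes components: "\<And>j. continuous_on {a..b} (\<lambda>t. c t j)"
  shows "integral {a..b} (\<lambda>t. linear_form (c t)) = linear_form (\<lambda>j. integral {a..b} (\<lambda>t. c t j))"
proof (rule blinfun_eqI)
  fix h
  have "(\<lambda>t. linear_form (c t)) integrable_on {a..b}"
    by (intro integrable_continuous_real continuous_on_linear_form components)
  then have "blinfun_apply (integral {a..b} (\<lambda>t. linear_form (c t))) h =
      integral {a..b} (\<lambda>t. \<Sum>j\<in>UNIV. h $ j * c t j)"
    by (simp add: blinfun_apply_integral blinfun_apply_linear_form)
  also have "\<dots> = (\<Sum>j\<in>UNIV. h $ j * integral {a..b} (\<lambda>t. c t j))"
    by (subst integral_sum)
      (auto intro!: integrable_continuous_real continuous_on_mult_left components)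
  finally show "blinfun_apply (integral {a..b} (\<lambda>t. linear_form (c t))) h =
      blinfun_apply (linear_form (\<lambda>j. integral {a..b} (\<lambda>t. c t j))) h"
    by (simp add: blinfun_apply_linear_form)
qed

lemma has_cgradient_integral_translate:
  fixes \<gamma> :: "real \<Rightarrow> complex ^ 'n::finite"
  assumes f: "holomorphic_sev_on f U" and partials: "\<And>j. continuous_on U (cpartial j f)"
    and \<gamma>: "continuous_on {a..b} \<gamma>" and \<phi>: "continuous_on {a..b} \<phi>"
    and V: "open V" "convex V" "x \<in> V"
    and translates: "\<And>x t. x \<in> V \<Longrightarrow> t \<in> {a..b} \<Longrightarrow> x + \<gamma> t \<in> U"
  shows "has_cgradient (\<lambda>x. integral {a..b} (\<lambda>t. f (x + \<gamma> t) * \<phi> t))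
    (\<lambda>j. integral {a..b} (\<lambda>t. cpartial j f (x + \<gamma> t) * \<phi> t)) x"
proof -
  define G where "G x t = linear_form (\<lambda>j. cpartial j f (x + \<gamma> t) * \<phi> t)" for x t
  have slice: "continuous_on {a..b} (\<lambda>t. g (y + \<gamma> t) * \<phi> t)"
    if "continuous_on U g" "y \<in> V" for g :: "complex ^ 'n \<Rightarrow> complex" and y
    by (intro continuous_on_mult[OF continuous_on_compose2[OF that(1)] \<phi>] continuous_on_add
        continuous_on_const \<gamma>) (use that(2) translates in auto)
  have "((\<lambda>x. integral (cbox a b) (\<lambda>t. f (x + \<gamma> t) * \<phi> t)) has_derivative
      blinfun_apply (integral (cbox a b) (G x))) (at x within V)"
  proof (rule leibniz_rule)
    fix y t assume "y \<in> V" "t \<in> cbox a b"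
    then have "has_cgradient (\<lambda>y. \<phi> t * f (y + \<gamma> t)) (\<lambda>j. \<phi> t * cpartial j f (y + \<gamma> t)) y"
      using translates by (intro has_cgradient_cmult has_cgradient_translate
          holomorphic_sev_on_imp_has_cgradient[OF f]) auto
    then show "((\<lambda>y. f (y + \<gamma> t) * \<phi> t) has_derivative blinfun_apply (G y t)) (at y within V)"
      unfolding G_def has_cgradient_iff_linear_form
      by (simp add: mult.commute[of "\<phi> t"] has_derivative_at_withinI)
  next
    show "continuous_on (V \<times> cbox a b) (\<lambda>(x, t). G x t)"
      using continuous_on_translate_integrand[OF partials \<gamma> \<phi> translates]
      unfolding G_def case_prod_unfold by (auto intro: continuous_on_linear_form)
    show "(\<lambda>t. f (y + \<gamma> t) * \<phi> t) integrable_on cbox a b" if "y \<in> V" for y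
      using slice[OF holomorphic_sev_on_imp_continuous_on[OF f] that]
      by (simp add: integrable_continuous_real)
  qed (use V in auto)
  moreover have "integral {a..b} (G x) =
      linear_form (\<lambda>j. integral {a..b} (\<lambda>t. cpartial j f (x + \<gamma> t) * \<phi> t))"
    unfolding G_def by (intro integral_linear_form slice partials V(3))
  ultimately show ?thesis
    using at_within_open[OF V(3,1)] by (simp add: has_cgradient_iff_linear_form)
qed

lemma circle_neighbourhood:
  assumes "open U" "x \<in> U"
  obtains r where "r > 0" "\<And>y t. y \<in> ball x r \<Longrightarrow> t \<in> cball 0 r \<Longrightarrow> y + axis i (t::complex) \<in> U"
proof -
  obtain s where s: "s > 0" "cball x s \<subseteq> U"
    using assms open_contains_cball by blast
  have "y + axis i t \<in> U" if "y \<in> ball x (s / 2)" "t \<in> cball 0 (s / 2)" for y and t :: complex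
  proof -
    have "dist x (y + axis i t) \<le> dist x y + norm t"
      using dist_triangle[of x "y + axis i t" y] by (simp add: dist_norm norm_axis)
    also have "\<dots> \<le> s" using that by simp
    finally show ?thesis using s(2) by auto
  qed
  with s(1) show thesis by (intro that[of "s / 2"]) auto
qed

lemma continuous_on_circlepath:
  assumes "r > 0"
  shows "continuous_on {0..1} (\<lambda>t. axis i (circlepath 0 r t) :: complex ^ 'n::finite)"
    and "continuous_on {0..1} (\<lambda>t. inverse (circlepath 0 r t))"
proof -
  have "continuous_on {0..1} (circlepath 0 r)"
    unfolding circlepath by (intro continuous_intros)
  moreover have "circlepath 0 r t \<noteq> 0" for t
    using assms by (simp add: circlepath)
  ultimately show "continuous_on {0..1} (\<lambda>t. axis i (circlepath 0 r t) :: complex ^ 'n)"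
    and "continuous_on {0..1} (\<lambda>t. inverse (circlepath 0 r t))"
    by (auto intro!: bounded_linear.continuous_on[OF bounded_linear_axis] continuous_on_inverse)
qed

lemma circlepath_in_cball: "r > 0 \<Longrightarrow> circlepath 0 r t \<in> cball 0 r"
  by (simp add: circlepath norm_mult)

lemma continuous_on_cpartial:
  assumes f: "holomorphic_sev_on f U" and U: "open U"
  shows "continuous_on U (cpartial i f)"
proof (rule continuous_at_imp_continuous_on, rule ballI)
  fix x assume "x \<in> U"
  then obtain r where r: "r > 0" and circle: "\<And>y t. y \<in> ball x r \<Longrightarrow> t \<in> cball 0 r \<Longrightarrow> y + axis i t \<in> U"
    using circle_neighbourhood[OF U] by blast
  have "continuous_on (ball x r)
      (\<lambda>y. integral {0..1} (\<lambda>t. f (y + axis i (circlepath 0 r t)) * inverse (circlepath 0 r t)))"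
    unfolding cbox_interval[symmetric]
    by (rule integral_continuous_on_param,
        rule continuous_on_translate_integrand[OF holomorphic_sev_on_imp_continuous_on[OF f]])
      (use r circle circlepath_in_cball continuous_on_circlepath in auto)
  then have "continuous_on (ball x r) (cpartial i f)"
    by (rule continuous_on_eq) (rule cpartial_eq_circle_integral[OF f r circle, symmetric])
  then show "isCont (cpartial i f) x"
    using r continuous_on_eq_continuous_at[OF open_ball] centre_in_ball by blast
qed

text \<open>Differentiating Cauchy's formula for \<open>\<partial>\<^sub>i f\<close> under the integral sign yields Cauchy's formula
  for \<open>\<partial>\<^sub>i (\<partial>\<^sub>j f)\<close> as its \<open>j\<close>-th derivative.\<close>

lemma has_cgradient_cpartial_circle_integral:
  assumes f: "holomorphic_sev_on f U" and U: "open U" and r: "r > 0"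
    and circle: "\<And>y t. y \<in> ball x r \<Longrightarrow> t \<in> cball 0 r \<Longrightarrow> y + axis i t \<in> U"
  shows "has_cgradient (cpartial i f) (\<lambda>j. integral {0..1}
    (\<lambda>t. cpartial j f (x + axis i (circlepath 0 r t)) * inverse (circlepath 0 r t))) x"
proof -
  have "has_cgradient
      (\<lambda>y. integral {0..1} (\<lambda>t. f (y + axis i (circlepath 0 r t)) * inverse (circlepath 0 r t)))
      (\<lambda>j. integral {0..1}
        (\<lambda>t. cpartial j f (x + axis i (circlepath 0 r t)) * inverse (circlepath 0 r t))) x"
    by (rule has_cgradient_integral_translate[where V = "ball x r"])
      (use f U r circle circlepath_in_cball continuous_on_cpartial continuous_on_circlepath in auto)
  then show ?thesis
    using has_cgradient_cong[of "ball x r" x "cpartial i f"] r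
      cpartial_eq_circle_integral[OF f r circle]
    by simp
qed

lemma holomorphic_sev_on_cpartial:
  assumes f: "holomorphic_sev_on f U" and U: "open U"
  shows "holomorphic_sev_on (cpartial i f) U"
proof -
  have "\<exists>c. has_cgradient (cpartial i f) c x" if x: "x \<in> U" for x
    by (rule circle_neighbourhood[OF U x, of i])
      (blast intro: has_cgradient_cpartial_circle_integral[OF f U])
  then show ?thesis by (metis holomorphic_sev_onI)
qed

lemma cpartial_commute:
  assumes f: "holomorphic_sev_on f U" and U: "open U" and x: "x \<in> U"
  shows "cpartial j (cpartial i f) x = cpartial i (cpartial j f) x"
proof -
  obtain r where r: "r > 0" and circle: "\<And>y t. y \<in> ball x r \<Longrightarrow> t \<in> cball 0 r \<Longrightarrow> y + axis i t \<in> U"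
    using circle_neighbourhood[OF U x] by blast
  have "cpartial i (cpartial j f) x =
      integral {0..1}
        (\<lambda>t. cpartial j f (x + axis i (circlepath 0 r t)) * inverse (circlepath 0 r t))"
    using r circle
    by (intro cpartial_eq_circle_integral[OF holomorphic_sev_on_cpartial[OF f U]]) auto
  then show ?thesis
    using has_cgradient_imp_cpartial[OF has_cgradient_cpartial_circle_integral[OF f U r circle]]
    by simp
qed

section \<open>Multi-exponents and iterated partial derivatives\<close>

lemma nat_vec_add_axis_induct [case_names zero add_axis]:
  fixes b :: "nat ^ 'n::finite"
  assumes zero: "P 0" and add_axis: "\<And>b i. P b \<Longrightarrow> P (b + axis i 1)"
  shows "P b"
proof (induction "\<Sum>i\<in>UNIV. b $ i" arbitrary: b)
  case 0
  then have "b = 0" by (simp add: vec_eq_iff)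
  with zero show ?case by simp
next
  case (Suc n)
  then obtain i where i: "b $ i \<noteq> 0"
    by (metis sum.neutral nat.distinct(1))
  then have b: "b = (b - axis i 1) + axis i 1"
    by (auto simp: vec_eq_iff axis_def)
  then have "(\<Sum>j\<in>UNIV. b $ j) = (\<Sum>j\<in>UNIV. (b - axis i 1) $ j + axis i 1 $ j)"
    by (metis vector_add_component)
  also have "\<dots> = (\<Sum>j\<in>UNIV. (b - axis i 1) $ j) + 1"
    unfolding sum.distrib by (simp add: axis_def)
  finally have "P (b - axis i 1)"
    using Suc by simp
  then show ?case
    by (subst b) (rule add_axis)
qed

definition vec_power :: "'a::comm_monoid_mult ^ 'n::finite \<Rightarrow> nat ^ 'n \<Rightarrow> 'a" where
  "vec_power x a = (\<Prod>j\<in>UNIV. x $ j ^ (a $ j))"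

lemma vec_power_0 [simp]: "vec_power x 0 = 1"
  by (simp add: vec_power_def)

lemma vec_power_add: "vec_power x (a + b) = vec_power x a * vec_power x b"
  by (simp add: vec_power_def power_add prod.distrib)

lemma vec_power_axis: "vec_power x (axis i 1) = x $ i"
proof -
  have "vec_power x (axis i 1) = (\<Prod>j\<in>UNIV. if j = i then x $ j else 1)"
    unfolding vec_power_def by (rule prod.cong) (auto simp: axis_def)
  then show ?thesis by simp
qed

lemma vec_power_diff_axis_mult:
  fixes x :: "'a::comm_semiring_1 ^ 'n::finite"
  shows "of_nat (a $ i) * vec_power x (a - axis i 1) * x $ i = of_nat (a $ i) * vec_power x a"
proof (cases "a $ i = 0")
  case False
  then have "a = (a - axis i 1) + axis i 1"
    by (auto simp: vec_eq_iff axis_def)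
  then have "vec_power x a = vec_power x (a - axis i 1) * x $ i"
    by (metis vec_power_add vec_power_axis)
  then show ?thesis by (simp add: mult.assoc)
qed simp

lemma has_cgradient_vec_power:
  "has_cgradient (\<lambda>y. vec_power y a) (\<lambda>i. of_nat (a $ i) * vec_power x (a - axis i 1)) x"
proof (induction a rule: nat_vec_add_axis_induct)
  case zero
  then show ?case by (simp add: has_cgradient_const)
next
  case (add_axis a i)
  have "has_cgradient (\<lambda>y. vec_power y (a + axis i 1))
      (\<lambda>l. vec_power x a * (if l = i then 1 else 0) +
        of_nat (a $ l) * vec_power x (a - axis l 1) * x $ i) x"
    unfolding vec_power_add vec_power_axis by (intro has_cgradient_mult has_cgradient_nth add_axis)
  moreover have "vec_power x a * (if l = i then 1 else 0) +
      of_nat (a $ l) * vec_power x (a - axis l 1) * x $ i =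
      of_nat ((a + axis i 1) $ l) * vec_power x (a + axis i 1 - axis l 1)" for l
  proof (cases "l = i")
    case True
    then show ?thesis
      using vec_power_diff_axis_mult[of a i x] by (simp add: algebra_simps)
  next
    case False
    then have commute: "a + axis i 1 - axis l 1 = (a - axis l 1) + axis i 1"
      by (simp add: vec_eq_iff axis_def)
    show ?thesis
      unfolding commute vec_power_add vec_power_axis using False by (simp add: axis_def mult.assoc)
  qed
  ultimately show ?case by simp
qed

definition falling_fact :: "('n::finite \<Rightarrow> 'a::comm_ring_1) \<Rightarrow> nat ^ 'n \<Rightarrow> 'a" where
  "falling_fact p b = (\<Prod>j\<in>UNIV. \<Prod>k<b $ j. p j - of_nat k)"

lemma falling_fact_0 [simp]: "falling_fact p 0 = 1"
  by (simp add: falling_fact_def)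

lemma falling_fact_add_axis:
  "falling_fact p (b + axis i 1) = (p i - of_nat (b $ i)) * falling_fact p b"
proof -
  have "falling_fact p (b + axis i 1) =
      (\<Prod>j\<in>UNIV. (if j = i then p i - of_nat (b $ i) else 1) * (\<Prod>k<b $ j. p j - of_nat k))"
    unfolding falling_fact_def by (rule prod.cong) (auto simp: axis_def)
  then show ?thesis by (simp add: prod.distrib falling_fact_def)
qed

lemma falling_fact_eq_0_iff:
  fixes p :: "'n::finite \<Rightarrow> 'a::idom"
  shows "falling_fact p b = 0 \<longleftrightarrow> (\<exists>j. \<exists>k<b $ j. p j = of_nat k)"
  by (auto simp: falling_fact_def prod_zero_iff)

lemma ex_list_count:
  fixes b :: "nat ^ 'n::finite"
  shows "\<exists>is. \<forall>i. count_list is i = b $ i"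
proof (induction b rule: nat_vec_add_axis_induct)
  case zero
  show ?case by (rule exI[of _ "[]"]) simp
next
  case (add_axis b i)
  then obtain "is" where "\<And>j. count_list is j = b $ j" by blast
  then show ?case by (intro exI[of _ "i # is"]) (simp add: axis_def)
qed

lemma holomorphic_sev_on_foldr_cpartial:
  "holomorphic_sev_on f U \<Longrightarrow> open U \<Longrightarrow> holomorphic_sev_on (foldr cpartial is f) U"
  by (induction "is") (auto intro: holomorphic_sev_on_cpartial)

lemma foldr_cpartial_remove1:
  assumes f: "holomorphic_sev_on f U" and U: "open U"
  shows "i \<in> set is \<Longrightarrow> x \<in> U \<Longrightarrow>
    foldr cpartial is f x = cpartial i (foldr cpartial (remove1 i is) f) x"
proof (induction "is" arbitrary: x)
  case (Cons j js)
  show ?case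
  proof (cases "i = j")
    case False
    then have i: "i \<in> set js" using Cons by auto
    have "cpartial j (foldr cpartial js f) x =
        cpartial j (cpartial i (foldr cpartial (remove1 i js) f)) x"
      by (rule cpartial_cong[OF U Cons.prems(2)])
        (auto intro: Cons.IH[OF i] holomorphic_sev_on_foldr_cpartial f U)
    also have "\<dots> = cpartial i (cpartial j (foldr cpartial (remove1 i js) f)) x"
      by (rule cpartial_commute[OF holomorphic_sev_on_foldr_cpartial[OF f U] U Cons.prems(2)])
    finally show ?thesis using False by simp
  qed simp
qed simp

lemma foldr_cpartial_mset_eq:
  assumes f: "holomorphic_sev_on f U" and U: "open U"
  shows "mset is = mset js \<Longrightarrow> x \<in> U \<Longrightarrow> foldr cpartial is f x = foldr cpartial js f x"
proof (induction "is" arbitrary: js x)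
  case (Cons i "is")
  then have i: "i \<in> set js" by (metis list.set_intros(1) set_mset_mset)
  have "mset is = mset (remove1 i js)" using Cons.prems(1)[symmetric] by simp
  note IH = Cons.IH[OF this]
  have "foldr cpartial (i # is) f x = cpartial i (foldr cpartial (remove1 i js) f) x"
    using cpartial_cong[OF U Cons.prems(2), of "foldr cpartial is f"
        "foldr cpartial (remove1 i js) f" i]
      IH holomorphic_sev_on_foldr_cpartial[OF f U] by simp
  then show ?case using foldr_cpartial_remove1[OF f U i Cons.prems(2)] by simp
qed simp

lemma multi_cpartial_eq_foldr:
  assumes f: "holomorphic_sev_on f U" and U: "open U" and x: "x \<in> U"
    and "is": "\<And>i. count_list is i = b $ i"
  shows "multi_cpartial b f x = foldr cpartial is f x"
  unfolding multi_cpartial_def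
proof (rule foldr_cpartial_mset_eq[OF f U _ x])
  have "\<forall>i. count_list (SOME is. \<forall>i. count_list is i = b $ i) i = b $ i"
    using ex_list_count by (rule someI_ex)
  then show "mset (SOME is. \<forall>i. count_list is i = b $ i) = mset is"
    using "is" by (simp add: multiset_eq_iff count_mset)
qed

lemma holomorphic_sev_on_multi_cpartial:
  "holomorphic_sev_on f U \<Longrightarrow> open U \<Longrightarrow> holomorphic_sev_on (multi_cpartial b f) U"
  unfolding multi_cpartial_def by (rule holomorphic_sev_on_foldr_cpartial)

context
  fixes f :: "complex ^ 'n::finite \<Rightarrow> complex" and U
  assumes f: "holomorphic_sev_on f U" and U: "open U"
begin

lemma multi_cpartial_0: "x \<in> U \<Longrightarrow> multi_cpartial 0 f x = f x"
  using multi_cpartial_eq_foldr[OF f U, of x "[]" 0] by simp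

lemma multi_cpartial_add_axis:
  assumes x: "x \<in> U"
  shows "multi_cpartial (b + axis i 1) f x = cpartial i (multi_cpartial b f) x"
proof -
  obtain "is" where "is": "\<And>i. count_list is i = b $ i" using ex_list_count by blast
  have "multi_cpartial (b + axis i 1) f x = foldr cpartial (i # is) f x"
    by (rule multi_cpartial_eq_foldr[OF f U x]) (simp add: "is" axis_def)
  also have "\<dots> = cpartial i (multi_cpartial b f) x"
    using cpartial_cong[OF U x, of "multi_cpartial b f" "foldr cpartial is f" i]
      multi_cpartial_eq_foldr[OF f U, of _ "is" b] "is" holomorphic_sev_on_multi_cpartial[OF f U]
    by simp
  finally show ?thesis .
qed

lemma multi_cpartial_axis: "x \<in> U \<Longrightarrow> multi_cpartial (axis i 1) f x = cpartial i f x"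
  using multi_cpartial_eq_foldr[OF f U, of x "[i]" "axis i 1"] by (simp add: axis_def)

lemma multi_cpartial_cpartial:
  assumes x: "x \<in> U"
  shows "multi_cpartial b (cpartial i f) x = multi_cpartial (b + axis i 1) f x"
proof -
  obtain "is" where "is": "\<And>i. count_list is i = b $ i" using ex_list_count by blast
  have "multi_cpartial (b + axis i 1) f x = foldr cpartial (is @ [i]) f x"
    by (rule multi_cpartial_eq_foldr[OF f U x]) (simp add: "is" axis_def)
  also have "\<dots> = multi_cpartial b (cpartial i f) x"
    using multi_cpartial_eq_foldr[OF holomorphic_sev_on_cpartial[OF f U] U x "is"] by simp
  finally show ?thesis by simp
qed

end

lemma multi_cpartial_lincomb:
  assumes f: "holomorphic_sev_on f U" and g: "holomorphic_sev_on g U" and U: "open U"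
  shows "x \<in> U \<Longrightarrow> multi_cpartial d (\<lambda>y. a * f y + b * g y) x =
    a * multi_cpartial d f x + b * multi_cpartial d g x"
proof (induction d arbitrary: x rule: nat_vec_add_axis_induct)
  case zero
  then show ?case
    by (simp add: multi_cpartial_0[OF _ U] f g holomorphic_sev_on_lincomb)
next
  case (add_axis d i)
  let ?h = "\<lambda>y. a * f y + b * g y"
  have h: "holomorphic_sev_on ?h U" by (rule holomorphic_sev_on_lincomb[OF f g])
  have "multi_cpartial (d + axis i 1) ?h x = cpartial i (multi_cpartial d ?h) x"
    by (rule multi_cpartial_add_axis[OF h U add_axis.prems])
  also have "\<dots> = cpartial i (\<lambda>y. a * multi_cpartial d f y + b * multi_cpartial d g y) x"
    by (rule cpartial_cong[OF U add_axis.prems add_axis.IH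
          holomorphic_sev_on_multi_cpartial[OF h U]])
  also have "\<dots> = a * multi_cpartial (d + axis i 1) f x + b * multi_cpartial (d + axis i 1) g x"
    unfolding multi_cpartial_add_axis[OF f U add_axis.prems]
      multi_cpartial_add_axis[OF g U add_axis.prems]
    by (rule cpartial_lincomb[OF holomorphic_sev_on_multi_cpartial[OF f U]
          holomorphic_sev_on_multi_cpartial[OF g U] add_axis.prems])
  finally show ?case .
qed

lemma multi_cpartial_cong:
  assumes f: "holomorphic_sev_on f U" and U: "open U" and agree: "\<And>y. y \<in> U \<Longrightarrow> f y = g y"
  shows "x \<in> U \<Longrightarrow> multi_cpartial b f x = multi_cpartial b g x"
proof (induction b arbitrary: x rule: nat_vec_add_axis_induct)
  case zero
  then show ?case
    using agree multi_cpartial_0[OF f U]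
      multi_cpartial_0[OF holomorphic_sev_on_cong[OF U agree f] U] by simp
next
  case (add_axis b i)
  then show ?case
    using multi_cpartial_add_axis[OF f U]
      multi_cpartial_add_axis[OF holomorphic_sev_on_cong[OF U agree f] U]
      cpartial_cong[OF U add_axis.prems add_axis.IH holomorphic_sev_on_multi_cpartial[OF f U]]
    by simp
qed

section \<open>Toric ideals\<close>

lemma poly_mapping_single_induct [case_names single add]:
  fixes p :: "'a \<Rightarrow>\<^sub>0 'b::comm_monoid_add"
  assumes single: "\<And>k c. P (Poly_Mapping.single k c)" and add: "\<And>p q. P p \<Longrightarrow> P q \<Longrightarrow> P (p + q)"
  shows "P p"
proof -
  have "P (\<Sum>k\<in>K. Poly_Mapping.single k (Poly_Mapping.lookup p k))" for K
    using single[of _ 0] by (induction K rule: infinite_finite_induct) (simp_all add: single add)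
  moreover have "p = (\<Sum>k\<in>Poly_Mapping.keys p. Poly_Mapping.single k (Poly_Mapping.lookup p k))"
    by (rule poly_mapping_eqI)
      (auto simp: lookup_sum lookup_single when_def in_keys_iff sum.delta' if_distrib cong: if_cong)
  ultimately show ?thesis by metis
qed

definition pm_eval :: "('a \<Rightarrow> 'b::comm_ring_1) \<Rightarrow> ('a \<Rightarrow>\<^sub>0 'b) \<Rightarrow> 'b" where
  "pm_eval \<phi> p = (\<Sum>k\<in>Poly_Mapping.keys p. Poly_Mapping.lookup p k * \<phi> k)"

lemma pm_eval_superset:
  assumes "finite K" "Poly_Mapping.keys p \<subseteq> K"
  shows "pm_eval \<phi> p = (\<Sum>k\<in>K. Poly_Mapping.lookup p k * \<phi> k)"
  unfolding pm_eval_def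
  by (rule sum.mono_neutral_left) (use assms in \<open>auto simp: in_keys_iff\<close>)

lemma pm_eval_zero [simp]: "pm_eval \<phi> 0 = 0"
  by (simp add: pm_eval_def)

lemma pm_eval_single [simp]: "pm_eval \<phi> (Poly_Mapping.single k c) = c * \<phi> k"
  using pm_eval_superset[of "{k}" "Poly_Mapping.single k c" \<phi>] by simp

lemma pm_eval_add: "pm_eval \<phi> (p + q) = pm_eval \<phi> p + pm_eval \<phi> q"
proof -
  let ?K = "Poly_Mapping.keys p \<union> Poly_Mapping.keys q"
  have "pm_eval \<phi> (p + q) = (\<Sum>k\<in>?K. Poly_Mapping.lookup (p + q) k * \<phi> k)"
    using Poly_Mapping.keys_add[of p q] by (intro pm_eval_superset) auto
  also have "\<dots> = pm_eval \<phi> p + pm_eval \<phi> q"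
    by (simp add: pm_eval_superset[of ?K] lookup_add algebra_simps sum.distrib)
  finally show ?thesis .
qed

lemma pm_eval_diff: "pm_eval \<phi> (p - q) = pm_eval \<phi> p - pm_eval \<phi> q"
  using pm_eval_add[of \<phi> "p - q" q] by simp

lemma pm_eval_sum: "pm_eval \<phi> (\<Sum>i\<in>I. p i) = (\<Sum>i\<in>I. pm_eval \<phi> (p i))"
  by (induction I rule: infinite_finite_induct) (simp_all add: pm_eval_add)

lemma pm_eval_mult: "pm_eval \<phi> (r * p) = pm_eval (\<lambda>c. pm_eval (\<lambda>b. \<phi> (c + b)) p) r"
proof (induction r rule: poly_mapping_single_induct)
  case (single c x)
  show ?case
    by (induction p rule: poly_mapping_single_induct)
      (simp_all add: mult_single distrib_left pm_eval_add mult.assoc)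
qed (simp add: distrib_right pm_eval_add)

lemma pm_eval_map_scale:
  fixes \<phi> :: "'a::monoid_add \<Rightarrow> 'b::comm_ring_1"
  shows "pm_eval \<phi> (Poly_Mapping.map ((*) c) p) = c * pm_eval \<phi> p"
  by (simp add: mult_map_scale_conv_mult pm_eval_mult)

lemma ideal_gen_induct [consumes 1, case_names zero add mult]:
  assumes "p \<in> ideal_gen S" and "P 0" and "\<And>p q. P p \<Longrightarrow> P q \<Longrightarrow> P (p + q)"
    and "\<And>r s. s \<in> S \<Longrightarrow> P (r * s)"
  shows "P p"
  using assms(1) unfolding ideal_gen_def
  by (rule module.span_induct_alt[OF module_ring_mult]) (use assms(2-4) in blast)+

lemma ideal_gen_base: "s \<in> S \<Longrightarrow> s \<in> ideal_gen S"
  unfolding ideal_gen_def by (rule module.span_base[OF module_ring_mult])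

lemma ideal_gen_mult: "s \<in> ideal_gen S \<Longrightarrow> r * s \<in> ideal_gen S"
  unfolding ideal_gen_def by (rule module.span_scale[OF module_ring_mult])

definition int_vec :: "nat ^ 'n \<Rightarrow> int ^ 'n" where
  "int_vec u = (\<chi> j. int (u $ j))"

lemma int_vec_nth [simp]: "int_vec u $ j = int (u $ j)"
  by (simp add: int_vec_def)

lemma int_vec_add: "int_vec (u + u') = int_vec u + int_vec u'"
  by (simp add: vec_eq_iff)

lemma int_vec_eq_iff: "int_vec u = int_vec u' \<longleftrightarrow> u = u'"
  by (simp add: vec_eq_iff)

lemma toric_ideal_binomial:
  "A *v int_vec u = A *v int_vec u' \<Longrightarrow> dmonom u - dmonom u' \<in> toric_ideal A"
  unfolding toric_ideal_def by (rule ideal_gen_base) (auto simp: int_vec_def)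

lemma pm_eval_toric_ideal:
  assumes p: "p \<in> toric_ideal A"
    and fibre: "\<And>u u'. A *v int_vec u = A *v int_vec u' \<Longrightarrow> \<phi> u = \<phi> u'"
  shows "pm_eval \<phi> p = 0"
  using p unfolding toric_ideal_def
proof (induction rule: ideal_gen_induct)
  case (mult r s)
  then obtain u u' where s: "s = dmonom u - dmonom u'" and u: "A *v int_vec u = A *v int_vec u'"
    by (auto simp: int_vec_def)
  have "\<phi> (c + u) = \<phi> (c + u')" for c
    by (rule fibre) (simp add: int_vec_add matrix_vector_right_distrib u)
  then show ?case
    by (simp add: s pm_eval_mult pm_eval_diff dmonom_def) (simp add: pm_eval_def)
qed (simp_all add: pm_eval_add)

section \<open>Solutions of hypergeometric systems\<close>

lemma weyl_apply_eq_pm_eval: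
  "weyl_apply P f x = pm_eval (\<lambda>(a, b). vec_power x a * multi_cpartial b f x) P"
  unfolding weyl_apply_def pm_eval_def vec_power_def by (intro sum.cong) (auto simp: mult.assoc)

lemma weyl_apply_weyl_of_dpoly:
  "weyl_apply (weyl_of_dpoly p) f x = pm_eval (\<lambda>b. multi_cpartial b f x) p"
  by (simp add: weyl_apply_eq_pm_eval weyl_of_dpoly_def pm_eval_sum) (simp add: pm_eval_def)

lemma weyl_apply_weyl_x: "weyl_apply (weyl_x i P) f x = x $ i * weyl_apply P f x"
  unfolding weyl_apply_eq_pm_eval weyl_x_def pm_eval_sum
  unfolding pm_eval_def[of _ P] sum_distrib_left
  by (intro sum.cong) (auto simp: vec_power_add vec_power_axis[unfolded One_nat_def])

lemma has_cgradient_weyl_apply: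
  assumes f: "holomorphic_sev_on f U" and U: "open U" and x: "x \<in> U"
  shows "has_cgradient (weyl_apply P f) (\<lambda>i. weyl_apply (weyl_d i P) f x) x"
proof -
  let ?coeff = "Poly_Mapping.lookup P"
  let ?term = "\<lambda>k y. vec_power y (fst k) * multi_cpartial (snd k) f y"
  let ?deriv = "\<lambda>i k. vec_power x (fst k) * cpartial i (multi_cpartial (snd k) f) x +
    of_nat (fst k $ i) * vec_power x (fst k - axis i 1) * multi_cpartial (snd k) f x"
  have "has_cgradient (\<lambda>y. ?coeff k * ?term k y) (\<lambda>i. ?coeff k * ?deriv i k) x" for k
    by (intro has_cgradient_cmult has_cgradient_mult has_cgradient_vec_power
        holomorphic_sev_on_imp_has_cgradient[OF holomorphic_sev_on_multi_cpartial[OF f U] x])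
  then have "has_cgradient (\<lambda>y. \<Sum>k\<in>Poly_Mapping.keys P. ?coeff k * ?term k y)
      (\<lambda>i. \<Sum>k\<in>Poly_Mapping.keys P. ?coeff k * ?deriv i k) x"
    by (rule has_cgradient_sum)
  moreover have "weyl_apply P f = (\<lambda>y. \<Sum>k\<in>Poly_Mapping.keys P. ?coeff k * ?term k y)"
    by (simp add: fun_eq_iff weyl_apply_eq_pm_eval pm_eval_def case_prod_unfold)
  moreover have "weyl_apply (weyl_d i P) f x =
      (\<Sum>k\<in>Poly_Mapping.keys P. ?coeff k * ?deriv i k)" for i
    unfolding weyl_apply_eq_pm_eval weyl_d_def pm_eval_sum case_prod_unfold
      pm_eval_add pm_eval_single fst_conv snd_conv multi_cpartial_add_axis[OF f U x]
    by (simp add: algebra_simps)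
  ultimately show ?thesis by simp
qed

lemma weyl_left_ideal_annihilates:
  assumes f: "holomorphic_sev_on f U" and U: "open U"
    and generators: "\<And>Q x. Q \<in> G \<Longrightarrow> x \<in> U \<Longrightarrow> weyl_apply Q f x = 0"
  shows "P \<in> weyl_left_ideal G \<Longrightarrow> x \<in> U \<Longrightarrow> weyl_apply P f x = 0"
proof (induction arbitrary: x rule: weyl_left_ideal.induct)
  case (mult_d P i)
  have "weyl_apply (weyl_d i P) f x = cpartial i (weyl_apply P f) x"
    using has_cgradient_imp_cpartial[OF has_cgradient_weyl_apply[OF f U mult_d.prems]] by simp
  also have "\<dots> = cpartial i (\<lambda>_. 0) x"
    using holomorphic_sev_onI[OF has_cgradient_weyl_apply[OF f U]]
    by (intro cpartial_cong[OF U mult_d.prems mult_d.IH])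
  finally show ?case by (simp add: cpartial_const)
qed (simp_all add: generators weyl_apply_weyl_x,
    simp_all add: weyl_apply_eq_pm_eval pm_eval_add pm_eval_map_scale)

lemma solutions_weyl_left_ideal_iff:
  assumes "open U"
  shows "f \<in> solutions U (weyl_left_ideal G) \<longleftrightarrow>
    holomorphic_sev_on f U \<and> (\<forall>x. x \<notin> U \<longrightarrow> f x = 0) \<and> (\<forall>P\<in>G. \<forall>x\<in>U. weyl_apply P f x = 0)"
  using weyl_left_ideal_annihilates[OF _ assms, of f G] weyl_left_ideal.gen[of _ G]
  by (auto simp: solutions_def)

definition log_partial :: "'n \<Rightarrow> (complex ^ 'n \<Rightarrow> complex) \<Rightarrow> complex ^ 'n::finite \<Rightarrow> complex" where
  "log_partial j f x = x $ j * cpartial j f x"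

lemma has_cgradient_log_partial:
  assumes "holomorphic_sev_on f U" "open U" "x \<in> U"
  shows "has_cgradient (log_partial j f)
    (\<lambda>i. x $ j * cpartial i (cpartial j f) x + (if i = j then cpartial j f x else 0)) x"
  using has_cgradient_mult[OF has_cgradient_nth
      holomorphic_sev_on_imp_has_cgradient[OF holomorphic_sev_on_cpartial[OF assms(1,2)]
        assms(3)], of j j]
  unfolding log_partial_def by (simp add: if_distrib[of "\<lambda>z. z * _"] cong: if_cong)

lemma holomorphic_sev_on_log_partial:
  "holomorphic_sev_on f U \<Longrightarrow> open U \<Longrightarrow> holomorphic_sev_on (log_partial j f) U"
  by (rule holomorphic_sev_onI) (rule has_cgradient_log_partial)

lemma log_partial_cong:
  assumes "open U" "x \<in> U" "\<And>y. y \<in> U \<Longrightarrow> f y = g y" "holomorphic_sev_on f U"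
  shows "log_partial i f x = log_partial i g x"
  unfolding log_partial_def using cpartial_cong[OF assms] by simp

lemma log_partial_cpartial:
  assumes f: "holomorphic_sev_on f U" and U: "open U" and x: "x \<in> U"
  shows "log_partial j (cpartial k f) x =
    cpartial k (log_partial j f) x - (if k = j then cpartial j f x else 0)"
  using has_cgradient_imp_cpartial[OF has_cgradient_log_partial[OF f U x]]
    cpartial_commute[OF f U x]
  by (simp add: log_partial_def)

lemma complex_mat_mult_nth: "(complex_mat A *v y) $ i = (\<Sum>j\<in>UNIV. of_int (A $ i $ j) * y $ j)"
  by (simp add: matrix_vector_mult_def complex_mat_def map_matrix_def)

lemma complex_mat_mult_axis: "(complex_mat A *v axis k 1) $ i = of_int (A $ i $ k)"
  by (simp add: complex_mat_mult_nth axis_def if_distrib[of "\<lambda>z. _ * z"] cong: if_cong)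

definition toric_solution :: "(complex ^ 'n) set \<Rightarrow> int ^ 'n::finite ^ 'd::finite \<Rightarrow>
    (complex ^ 'n \<Rightarrow> complex) \<Rightarrow> bool" where
  "toric_solution U A f \<longleftrightarrow> (\<forall>u u'. A *v int_vec u = A *v int_vec u' \<longrightarrow>
     (\<forall>x\<in>U. multi_cpartial u f x = multi_cpartial u' f x))"

definition euler_solution :: "(complex ^ 'n) set \<Rightarrow> int ^ 'n::finite ^ 'd::finite \<Rightarrow> complex ^ 'd \<Rightarrow>
    (complex ^ 'n \<Rightarrow> complex) \<Rightarrow> bool" where
  "euler_solution U A \<gamma> f \<longleftrightarrow> (\<forall>x\<in>U. complex_mat A *v (\<chi> j. log_partial j f x) = f x *s \<gamma>)"

lemma toric_solution_iff_annihilates: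
  "toric_solution U A f \<longleftrightarrow> (\<forall>p\<in>toric_ideal A. \<forall>x\<in>U. weyl_apply (weyl_of_dpoly p) f x = 0)"
proof
  show "\<forall>p\<in>toric_ideal A. \<forall>x\<in>U. weyl_apply (weyl_of_dpoly p) f x = 0" if "toric_solution U A f"
    using that unfolding toric_solution_def weyl_apply_weyl_of_dpoly
    by (blast intro: pm_eval_toric_ideal)
  assume annihilates: "\<forall>p\<in>toric_ideal A. \<forall>x\<in>U. weyl_apply (weyl_of_dpoly p) f x = 0"
  show "toric_solution U A f"
    unfolding toric_solution_def
  proof (intro allI impI ballI)
    fix u u' x assume "A *v int_vec u = A *v int_vec u'" "x \<in> U"
    then have "weyl_apply (weyl_of_dpoly (dmonom u - dmonom u')) f x = 0"
      using annihilates toric_ideal_binomial by blast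
    then show "multi_cpartial u f x = multi_cpartial u' f x"
      by (simp add: weyl_apply_weyl_of_dpoly pm_eval_diff dmonom_def)
  qed
qed

lemma weyl_apply_euler_op:
  assumes "holomorphic_sev_on f U" "open U" "x \<in> U"
  shows "weyl_apply (euler_op A \<gamma> i) f x =
    (complex_mat A *v (\<chi> j. log_partial j f x)) $ i - \<gamma> $ i * f x"
  unfolding weyl_apply_eq_pm_eval euler_op_def pm_eval_diff pm_eval_sum pm_eval_single prod.case
    vec_power_axis multi_cpartial_axis[OF assms] vec_power_0 multi_cpartial_0[OF assms]
  by (simp add: complex_mat_mult_nth log_partial_def)

lemma euler_solution_iff_annihilates:
  assumes "holomorphic_sev_on f U" "open U"
  shows "euler_solution U A \<gamma> f \<longleftrightarrow> (\<forall>i. \<forall>x\<in>U. weyl_apply (euler_op A \<gamma> i) f x = 0)"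
  unfolding euler_solution_def vec_eq_iff
  by (auto simp: weyl_apply_euler_op[OF assms] mult.commute)

lemma solutions_hypergeometric_ideal_iff:
  assumes "open U"
  shows "f \<in> solutions U (hypergeometric_ideal A \<gamma>) \<longleftrightarrow>
    holomorphic_sev_on f U \<and> (\<forall>x. x \<notin> U \<longrightarrow> f x = 0) \<and> toric_solution U A f \<and> euler_solution U A \<gamma> f"
  using toric_solution_iff_annihilates[of U A f] euler_solution_iff_annihilates[of f U A \<gamma>] assms
  unfolding hypergeometric_ideal_def solutions_weyl_left_ideal_iff[OF assms] ball_Un by auto

lemma weyl_apply_lincomb:
  assumes "holomorphic_sev_on f U" "holomorphic_sev_on g U" "open U" "x \<in> U"
  shows "weyl_apply P (\<lambda>y. a * f y + b * g y) x = a * weyl_apply P f x + b * weyl_apply P g x"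
  by (simp add: weyl_apply_eq_pm_eval pm_eval_def multi_cpartial_lincomb[OF assms] case_prod_unfold
      sum_distrib_left sum.distrib distrib_left mult.left_commute)

lemma multi_cpartial_zero_fun: "multi_cpartial b (\<lambda>_. 0) x = 0"
  using multi_cpartial_lincomb[OF holomorphic_sev_on_const holomorphic_sev_on_const open_UNIV,
      of x b 0 0 0 0]
  by simp

lemma subspace_solutions:
  assumes "open U"
  shows "module.subspace fun_scale (solutions U H)"
proof -
  have zero: "(\<lambda>_. 0) \<in> solutions U H"
    by (simp add: solutions_def holomorphic_sev_on_const weyl_apply_def multi_cpartial_zero_fun
        case_prod_unfold)
  have lincomb: "(\<lambda>x. a * f x + b * g x) \<in> solutions U H"
    if "f \<in> solutions U H" "g \<in> solutions U H" for a b f g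
    using that
    by (simp add: solutions_def holomorphic_sev_on_lincomb weyl_apply_lincomb[OF _ _ assms])
  show ?thesis
    unfolding module.subspace_def[OF module_fun_scale]
    using zero lincomb[of _ _ 1 1] lincomb[OF _ zero, of _ _ 0]
    by (simp add: zero_fun_def plus_fun_def fun_scale_def)
qed

lemma subspace_kernel_linear_map_between:
  assumes X: "module.subspace fun_scale X" and T: "linear_map_between X Y T"
  shows "module.subspace fun_scale {f \<in> X. T f = 0}"
proof -
  interpret module fun_scale by (rule module_fun_scale)
  have "T (fun_scale 0 0) = fun_scale 0 (T 0)"
    using T subspace_0[OF X] unfolding linear_map_between_def by blast
  then have "T 0 = 0" by simp
  then show ?thesis
    using X T by (simp add: subspace_def linear_map_between_def)
qed

subsection \<open>Differentiation of solutions\<close>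

lemma toric_solution_cong:
  assumes "open U" "\<And>x. x \<in> U \<Longrightarrow> f x = g x" "holomorphic_sev_on f U" "toric_solution U A f"
  shows "toric_solution U A g"
  unfolding toric_solution_def
proof (intro allI impI ballI)
  fix u u' x assume "A *v int_vec u = A *v int_vec u'" "x \<in> U"
  then show "multi_cpartial u g x = multi_cpartial u' g x"
    using assms(4) multi_cpartial_cong[OF assms(3,1,2), of x] unfolding toric_solution_def by metis
qed

lemma euler_solution_cong:
  assumes "open U" "\<And>x. x \<in> U \<Longrightarrow> f x = g x" "holomorphic_sev_on f U" "euler_solution U A \<gamma> f"
  shows "euler_solution U A \<gamma> g"
  using assms(4) log_partial_cong[OF assms(1) _ assms(2,3)] assms(2)
  by (simp add: euler_solution_def)

lemma toric_solution_cpartial: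
  assumes f: "holomorphic_sev_on f U" and U: "open U" and toric: "toric_solution U A f"
  shows "toric_solution U A (cpartial k f)"
  unfolding toric_solution_def
proof (intro allI impI ballI)
  fix u u' x assume "A *v int_vec u = A *v int_vec u'" and x: "x \<in> U"
  then have "A *v int_vec (u + axis k 1) = A *v int_vec (u' + axis k 1)"
    by (simp add: int_vec_add matrix_vector_right_distrib)
  then show "multi_cpartial u (cpartial k f) x = multi_cpartial u' (cpartial k f) x"
    using toric x unfolding multi_cpartial_cpartial[OF f U x] toric_solution_def by blast
qed

lemma euler_solution_cpartial:
  assumes f: "holomorphic_sev_on f U" and U: "open U" and euler: "euler_solution U A \<gamma> f"
  shows "euler_solution U A (\<gamma> - complex_mat A *v axis k 1) (cpartial k f)"
  unfolding euler_solution_def vec_eq_iff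
proof (intro allI ballI)
  fix i x assume x: "x \<in> U"
  let ?E = "\<lambda>y. \<Sum>j\<in>UNIV. of_int (A $ i $ j) * log_partial j f y"
  have "?E y = \<gamma> $ i * f y" if "y \<in> U" for y
    using euler that by (simp add: euler_solution_def vec_eq_iff complex_mat_mult_nth)
  then have euler_gradient: "has_cgradient ?E (\<lambda>k. \<gamma> $ i * cpartial k f x) x"
    using has_cgradient_cong[OF U x, of ?E]
      has_cgradient_cmult[OF holomorphic_sev_on_imp_has_cgradient[OF f x]] by simp
  have termwise_gradient: "has_cgradient ?E
      (\<lambda>k. \<Sum>j\<in>UNIV. of_int (A $ i $ j) * cpartial k (log_partial j f) x) x"
    by (intro has_cgradient_sum has_cgradient_cmult
        holomorphic_sev_on_imp_has_cgradient[OF holomorphic_sev_on_log_partial[OF f U] x])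
  have "(\<Sum>j\<in>UNIV. of_int (A $ i $ j) * cpartial k (log_partial j f) x) = cpartial k f x * \<gamma> $ i"
    using fun_cong[OF has_cgradient_unique[OF termwise_gradient euler_gradient], of k]
    by (simp only: mult.commute[of "\<gamma> $ i"])
  then show "(complex_mat A *v (\<chi> j. log_partial j (cpartial k f) x)) $ i =
      (cpartial k f x *s (\<gamma> - complex_mat A *v axis k 1)) $ i"
    by (simp add: complex_mat_mult_nth[of A "\<chi> j. _ j"] complex_mat_mult_axis
        log_partial_cpartial[OF f U x]
        right_diff_distrib sum_subtractf if_distrib[of "\<lambda>z. of_int _ * z"] cong: if_cong)
qed

lemma linear_map_between_cpartial_on:
  assumes U: "open U"
  shows "linear_map_between (solutions U (hypergeometric_ideal A \<gamma>))
    (solutions U (hypergeometric_ideal A (\<gamma> - complex_mat A *v axis k 1))) (cpartial_on U k)"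
proof -
  have "cpartial_on U k f \<in> solutions U (hypergeometric_ideal A (\<gamma> - complex_mat A *v axis k 1))"
    if "f \<in> solutions U (hypergeometric_ideal A \<gamma>)" for f
  proof -
    have f: "holomorphic_sev_on f U" "toric_solution U A f" "euler_solution U A \<gamma> f"
      using that unfolding solutions_hypergeometric_ideal_iff[OF U] by auto
    have agree: "cpartial k f y = cpartial_on U k f y" if "y \<in> U" for y
      using that by (simp add: cpartial_on_def)
    note holomorphic = holomorphic_sev_on_cpartial[OF f(1) U]
    show ?thesis
      unfolding solutions_hypergeometric_ideal_iff[OF U]
      using holomorphic_sev_on_cong[OF U agree holomorphic]
        toric_solution_cong[OF U agree holomorphic toric_solution_cpartial[OF f(1) U f(2)]]
        euler_solution_cong[OF U agree holomorphic euler_solution_cpartial[OF f(1) U f(3)]]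
      by (simp add: cpartial_on_def)
  qed
  moreover have "cpartial_on U k (\<lambda>x. a * f x + b * g x) =
      (\<lambda>x. a * cpartial_on U k f x + b * cpartial_on U k g x)"
    if "holomorphic_sev_on f U" "holomorphic_sev_on g U" for a b f g
    by (simp add: cpartial_on_def fun_eq_iff cpartial_lincomb[OF that])
  from this[of _ _ 1 1] this[of _ _ _ 0]
  have "cpartial_on U k (f + g) = cpartial_on U k f + cpartial_on U k g"
    and "cpartial_on U k (fun_scale c f) = fun_scale c (cpartial_on U k f)"
    if "holomorphic_sev_on f U" "holomorphic_sev_on g U" for f g c
    using that by (simp_all add: fun_scale_def plus_fun_def)
  ultimately show ?thesis
    unfolding linear_map_between_def by (auto simp: solutions_def)
qed

section \<open>Monomials with complex exponents\<close>

lemma log_branches_nonzero: "log_branches U L \<Longrightarrow> x \<in> U \<Longrightarrow> x $ j \<noteq> 0"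
  unfolding log_branches_def by (metis exp_not_eq_zero)

lemma has_cgradient_log_branch:
  assumes L: "log_branches U L" and U: "open U" and x: "x \<in> U"
  shows "has_cgradient (L i) (\<lambda>j. if j = i then 1 / x $ i else 0) x"
proof -
  have continuous: "continuous_on U (L i)" and exp_L: "\<And>y. y \<in> U \<Longrightarrow> exp (L i y) = y $ i"
    using L by (auto simp: log_branches_def)
  define V where "V = U \<inter> L i -` ball (L i x) 1"
  have V: "open V" "x \<in> V"
    using continuous_open_preimage[OF continuous U open_ball] x by (auto simp: V_def)
  have local_branch: "L i x + Ln (y $ i / x $ i) = L i y" if "y \<in> V" for y
  proof -
    have "norm (L i y - L i x) < 1" using that by (simp add: V_def dist_norm norm_minus_commute)
    then have "\<bar>Im (L i y - L i x)\<bar> < pi"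
      using abs_Im_le_cmod[of "L i y - L i x"] pi_gt3 by linarith
    then have "Ln (exp (L i y - L i x)) = L i y - L i x" by (intro Ln_exp) auto
    moreover have "exp (L i y - L i x) = y $ i / x $ i"
      using that exp_L x by (simp add: exp_diff V_def)
    ultimately show ?thesis by simp
  qed
  have "has_cgradient (\<lambda>y. L i x + Ln (y $ i / x $ i))
      (\<lambda>j. (1 / x $ i) * (if j = i then 1 else 0)) x"
    by (rule has_cgradient_compose[OF has_cgradient_nth, where g = "\<lambda>z. L i x + Ln (z / x $ i)"])
      (use log_branches_nonzero[OF L x] in \<open>auto intro!: derivative_eq_intros simp: field_simps\<close>)
  then show ?thesis
    using has_cgradient_cong[OF V local_branch]
    by (simp add: if_distrib[of "\<lambda>z. _ * z"] cong: if_cong)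
qed

lemma cmonomial_on_eq_exp: "x \<in> U \<Longrightarrow> cmonomial_on U L u x = exp (\<Sum>i\<in>UNIV. u $ i * L i x)"
  by (simp add: cmonomial_on_def exp_sum)

lemma cmonomial_on_add:
  "x \<in> U \<Longrightarrow> cmonomial_on U L (u + w) x = cmonomial_on U L u x * cmonomial_on U L w x"
  by (simp add: cmonomial_on_eq_exp distrib_right sum.distrib exp_add)

lemma cmonomial_on_0: "x \<in> U \<Longrightarrow> cmonomial_on U L 0 x = 1"
  by (simp add: cmonomial_on_def)

lemma cmonomial_on_diff_axis_mult:
  assumes "log_branches U L" "x \<in> U"
  shows "x $ j * cmonomial_on U L (u - axis j 1) x = cmonomial_on U L u x"
proof -
  have "cmonomial_on U L (axis j 1) x = x $ j"
    using assms by (simp add: cmonomial_on_eq_exp sum_axis_mult log_branches_def)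
  then show ?thesis
    using cmonomial_on_add[OF assms(2), of L "u - axis j 1" "axis j 1"] by simp
qed

lemma has_cgradient_cmonomial_on:
  assumes L: "log_branches U L" and U: "open U" and x: "x \<in> U"
  shows "has_cgradient (cmonomial_on U L u) (\<lambda>j. u $ j * cmonomial_on U L (u - axis j 1) x) x"
proof -
  have "has_cgradient (\<lambda>y. exp (\<Sum>i\<in>UNIV. u $ i * L i y))
      (\<lambda>j. exp (\<Sum>i\<in>UNIV. u $ i * L i x) * (\<Sum>i\<in>UNIV. u $ i * (if j = i then 1 / x $ i else 0))) x"
    by (intro has_cgradient_compose[OF has_cgradient_sum] has_cgradient_cmult
        has_cgradient_log_branch[OF L U x] DERIV_exp)
  moreover have "exp (\<Sum>i\<in>UNIV. u $ i * L i x) *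
      (\<Sum>i\<in>UNIV. u $ i * (if j = i then 1 / x $ i else 0)) =
      u $ j * cmonomial_on U L (u - axis j 1) x" for j
    using cmonomial_on_diff_axis_mult[OF L x, of j u] log_branches_nonzero[OF L x, of j]
    by (simp add: cmonomial_on_eq_exp[OF x, symmetric] if_distrib[of "\<lambda>z. _ * z"]
        field_simps cong: if_cong)
  ultimately show ?thesis
    using has_cgradient_cong[OF U x, of "cmonomial_on U L u", OF cmonomial_on_eq_exp] by simp
qed

lemma holomorphic_sev_on_cmonomial_on:
  "log_branches U L \<Longrightarrow> open U \<Longrightarrow> holomorphic_sev_on (cmonomial_on U L u) U"
  by (rule holomorphic_sev_onI) (rule has_cgradient_cmonomial_on)

lemma log_partial_cmonomial_on:
  assumes "log_branches U L" "open U" "x \<in> U"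
  shows "log_partial j (cmonomial_on U L u) x = u $ j * cmonomial_on U L u x"
  using cmonomial_on_diff_axis_mult[OF assms(1,3), of j u]
    has_cgradient_imp_cpartial[OF has_cgradient_cmonomial_on[OF assms]]
  by (simp add: log_partial_def)

lemma multi_cpartial_cmonomial_on:
  assumes L: "log_branches U L" and U: "open U"
  shows "x \<in> U \<Longrightarrow> multi_cpartial b (cmonomial_on U L u) x =
    falling_fact (($) u) b * cmonomial_on U L (u - (\<chi> i. of_nat (b $ i))) x"
proof (induction b arbitrary: x rule: nat_vec_add_axis_induct)
  case zero
  have "(\<chi> i. 0) = (0 :: complex ^ 'a)" by (simp add: vec_eq_iff)
  with zero show ?case
    by (simp add: multi_cpartial_0[OF holomorphic_sev_on_cmonomial_on[OF L U] U])
next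
  case (add_axis b i)
  let ?w = "u - (\<chi> i. of_nat (b $ i))"
  note holomorphic = holomorphic_sev_on_cmonomial_on[OF L U]
  have "multi_cpartial (b + axis i 1) (cmonomial_on U L u) x =
      cpartial i (multi_cpartial b (cmonomial_on U L u)) x"
    by (rule multi_cpartial_add_axis[OF holomorphic U add_axis.prems])
  also have "\<dots> = cpartial i (\<lambda>y. falling_fact (($) u) b * cmonomial_on U L ?w y) x"
    by (rule cpartial_cong[OF U add_axis.prems add_axis.IH
          holomorphic_sev_on_multi_cpartial[OF holomorphic U]])
  also have "\<dots> = falling_fact (($) u) b * (?w $ i * cmonomial_on U L (?w - axis i 1) x)"
    by (rule has_cgradient_imp_cpartial[OF has_cgradient_cmult[OF
            has_cgradient_cmonomial_on[OF L U add_axis.prems]]])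
  also have "?w - axis i 1 = u - (\<chi> j. of_nat ((b + axis i 1) $ j))"
    by (auto simp: vec_eq_iff axis_def)
  finally show ?case
    unfolding falling_fact_add_axis by (simp add: mult_ac)
qed

lemma euler_solution_cmonomial_on:
  assumes "log_branches U L" "open U"
  shows "euler_solution U A (complex_mat A *v u) (cmonomial_on U L u)"
  by (simp add: euler_solution_def vec_eq_iff complex_mat_mult_nth
      log_partial_cmonomial_on[OF assms]
      sum_distrib_left mult_ac)

lemma homogeneous_imp_multiple_cmonomial_on:
  assumes L: "log_branches U L" and U: "open U" "connected U" "U \<noteq> {}"
    and f: "holomorphic_sev_on f U" and outside: "\<And>x. x \<notin> U \<Longrightarrow> f x = 0"
    and homogeneous: "\<And>x j. x \<in> U \<Longrightarrow> log_partial j f x = v $ j * f x"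
  shows "\<exists>c. f = fun_scale c (cmonomial_on U L v)"
proof -
  define g where "g x = f x * cmonomial_on U L (- v) x" for x
  have "(g has_derivative (\<lambda>h. 0)) (at x)" if x: "x \<in> U" for x
  proof -
    let ?grad = "\<lambda>j. f x * ((- v) $ j * cmonomial_on U L (- v - axis j 1) x) +
        cpartial j f x * cmonomial_on U L (- v) x"
    have "has_cgradient g ?grad x"
      unfolding g_def
      by (intro has_cgradient_mult has_cgradient_cmonomial_on[OF L U(1) x]
          holomorphic_sev_on_imp_has_cgradient[OF f x])
    moreover have "?grad j = 0" for j
    proof -
      have "x $ j * ?grad j = (log_partial j f x - v $ j * f x) * cmonomial_on U L (- v) x"
        unfolding cmonomial_on_diff_axis_mult[OF L x, of j "- v", symmetric]
        by (simp add: log_partial_def algebra_simps)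
      then show ?thesis using homogeneous[OF x] log_branches_nonzero[OF L x, of j] by simp
    qed
    ultimately show ?thesis by (simp add: has_cgradient_def)
  qed
  then obtain c where g_constant: "\<And>x. x \<in> U \<Longrightarrow> g x = c"
    using has_derivative_zero_unique_connected[OF U(1,2)] U(3) by (metis ex_in_conv)
  have "f x = c * cmonomial_on U L v x" for x
  proof (cases "x \<in> U")
    case True
    then have "cmonomial_on U L (- v) x * cmonomial_on U L v x = 1"
      using cmonomial_on_add[OF True, of L "- v" v] by (simp add: cmonomial_on_0)
    then show ?thesis using g_constant[OF True] by (metis g_def mult.assoc mult.right_neutral)
  qed (simp add: outside cmonomial_on_def)
  then show ?thesis by (auto simp: fun_scale_def fun_eq_iff)
qed

section \<open>Functions on a line of exponents\<close>

lemma one_in_poly_ideal: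
  fixes I :: "'a::alg_closed_field poly set"
  assumes add: "\<And>p q. p \<in> I \<Longrightarrow> q \<in> I \<Longrightarrow> p + q \<in> I"
    and mult: "\<And>p q. p \<in> I \<Longrightarrow> q * p \<in> I"
    and no_common_root: "\<And>z. \<exists>p\<in>I. poly p z \<noteq> 0"
  shows "1 \<in> I"
proof -
  have "\<exists>p. p \<in> I \<and> p \<noteq> 0" using no_common_root[of 0] by auto
  then obtain g where g: "g \<in> I" "g \<noteq> 0" and minimal: "\<And>p. p \<in> I \<Longrightarrow> p \<noteq> 0 \<Longrightarrow> degree g \<le> degree p"
    using ex_has_least_nat[of "\<lambda>p. p \<in> I \<and> p \<noteq> 0" _ degree] by metis
  have "g dvd p" if "p \<in> I" for p
  proof (rule ccontr)
    assume "\<not> g dvd p"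
    then have "p mod g \<noteq> 0" by (simp add: dvd_eq_mod_eq_0)
    moreover have "p mod g = p + (- (p div g)) * g" by (simp add: minus_div_mult_eq_mod[symmetric])
    then have "p mod g \<in> I" using add[OF that mult[OF g(1)]] by metis
    ultimately show False using minimal[of "p mod g"] degree_mod_less[OF g(2), of p] by simp
  qed
  then have "poly g z \<noteq> 0" for z
    using no_common_root[of z] by (metis dvdE mult_zero_left poly_mult)
  then have "degree g = 0"
    using alg_closed_imp_poly_has_root[of g] by auto
  then obtain c where "g = [:c:]" using degree_eq_zeroE by blast
  then have "1 = [:inverse c:] * g" using g(2) by (simp add: one_pCons)
  then show ?thesis using mult[OF g(1)] by metis
qed

lemma log_partial_lincomb:
  assumes "holomorphic_sev_on f U" "holomorphic_sev_on g U" "x \<in> U"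
  shows "log_partial j (\<lambda>y. a * f y + b * g y) x = a * log_partial j f x + b * log_partial j g x"
  using cpartial_lincomb[OF assms] by (simp add: log_partial_def algebra_simps)

lemma log_partial_commute:
  assumes "holomorphic_sev_on f U" "open U" "x \<in> U"
  shows "log_partial i (log_partial j f) x = log_partial j (log_partial i f) x"
  using has_cgradient_imp_cpartial[OF has_cgradient_log_partial[OF assms]]
    cpartial_commute[OF assms, of i j]
  by (simp add: log_partial_def algebra_simps)

text \<open>Writing \<open>f = x\<^sup>v h(log x\<^sup>m)\<close>, the operator \<open>slope\<close> replaces \<open>h\<close> by its derivative.\<close>

locale log_line =
  fixes U :: "(complex ^ 'n::finite) set" and f :: "complex ^ 'n \<Rightarrow> complex"
    and v :: "complex ^ 'n" and m :: "'n \<Rightarrow> complex" and l :: 'n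
  assumes U: "open U" and f: "holomorphic_sev_on f U" and m_nonzero: "m l \<noteq> 0"
    and line: "\<And>x. x \<in> U \<Longrightarrow> \<exists>s. \<forall>j. log_partial j f x = v $ j * f x + m j * s"
begin

definition slope :: "(complex ^ 'n \<Rightarrow> complex) \<Rightarrow> complex ^ 'n \<Rightarrow> complex" where
  "slope g x = 1 / m l * log_partial l g x + (- v $ l / m l) * g x"

lemma log_partial_slope: "x \<in> U \<Longrightarrow> log_partial j f x = v $ j * f x + m j * slope f x"
proof -
  assume "x \<in> U"
  then obtain s where s: "\<And>j. log_partial j f x = v $ j * f x + m j * s" using line by blast
  have "slope f x = s" using m_nonzero by (simp add: slope_def s[of l] field_simps)
  then show ?thesis by (simp add: s)
qed

lemma slope_zero: "slope (\<lambda>_. 0) x = 0"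
  by (simp add: slope_def log_partial_def cpartial_const)

lemma holomorphic_sev_on_slope: "holomorphic_sev_on g U \<Longrightarrow> holomorphic_sev_on (slope g) U"
  unfolding slope_def by (intro holomorphic_sev_on_lincomb holomorphic_sev_on_log_partial U)

lemma slope_cong:
  "x \<in> U \<Longrightarrow> (\<And>y. y \<in> U \<Longrightarrow> g y = h y) \<Longrightarrow> holomorphic_sev_on g U \<Longrightarrow> slope g x = slope h x"
  unfolding slope_def using log_partial_cong[OF U, of x g h l] by simp

lemma slope_lincomb:
  assumes "holomorphic_sev_on g U" "holomorphic_sev_on h U" "x \<in> U"
  shows "slope (\<lambda>y. a * g y + b * h y) x = a * slope g x + b * slope h x"
  by (simp add: slope_def log_partial_lincomb[OF assms] algebra_simps)

lemma log_partial_slope_commute: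
  assumes g: "holomorphic_sev_on g U" and x: "x \<in> U"
  shows "log_partial j (slope g) x = slope (log_partial j g) x"
  unfolding slope_def[abs_def]
  by (simp only: log_partial_lincomb[OF holomorphic_sev_on_log_partial[OF g U] g x]
      log_partial_commute[OF g U x])

definition poly_act :: "complex poly \<Rightarrow> complex ^ 'n \<Rightarrow> complex" where
  "poly_act p = fold_coeffs (\<lambda>a g x. a * f x + slope g x) p (\<lambda>_. 0)"

lemma poly_act_0 [simp]: "poly_act 0 = (\<lambda>_. 0)"
  by (simp add: poly_act_def)

lemma poly_act_pCons: "poly_act (pCons a p) = (\<lambda>x. a * f x + slope (poly_act p) x)"
  by (cases "a = 0 \<and> p = 0") (auto simp: poly_act_def slope_zero)

lemma holomorphic_sev_on_poly_act: "holomorphic_sev_on (poly_act p) U"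
proof (induction p)
  case (pCons a p)
  then show ?case
    using holomorphic_sev_on_lincomb[OF f holomorphic_sev_on_slope, of "poly_act p" a 1]
    by (simp add: poly_act_pCons)
qed (simp add: holomorphic_sev_on_const)

lemma poly_act_add: "x \<in> U \<Longrightarrow> poly_act (p + q) x = poly_act p x + poly_act q x"
proof (induction p q arbitrary: x rule: poly_induct2)
  case (pCons a p b q)
  have "slope (poly_act (p + q)) x = slope (\<lambda>y. 1 * poly_act p y + 1 * poly_act q y) x"
    using pCons by (intro slope_cong holomorphic_sev_on_poly_act) auto
  also have "\<dots> = slope (poly_act p) x + slope (poly_act q) x"
    using slope_lincomb[OF holomorphic_sev_on_poly_act
        holomorphic_sev_on_poly_act pCons.prems, of 1 p 1 q]
    by simp
  finally show ?case by (simp add: poly_act_pCons algebra_simps)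
qed simp

lemma poly_act_smult: "x \<in> U \<Longrightarrow> poly_act (smult c p) x = c * poly_act p x"
proof (induction p arbitrary: x)
  case (pCons a p)
  have "slope (poly_act (smult c p)) x = slope (\<lambda>y. c * poly_act p y + 0 * poly_act p y) x"
    using pCons by (intro slope_cong holomorphic_sev_on_poly_act) auto
  also have "\<dots> = c * slope (poly_act p) x"
    using slope_lincomb[OF holomorphic_sev_on_poly_act
        holomorphic_sev_on_poly_act pCons.prems, of c p 0 p]
    by simp
  finally show ?case by (simp add: poly_act_pCons algebra_simps)
qed simp

lemma poly_act_linear_mult:
  assumes "x \<in> U"
  shows "poly_act ([:a, b:] * p) x = a * poly_act p x + b * slope (poly_act p) x"
proof -
  have "[:a, b:] * p = smult a p + smult b (pCons 0 p)" by simp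
  then show ?thesis
    using assms by (simp only: poly_act_add poly_act_smult) (simp add: poly_act_pCons)
qed

lemma log_partial_poly_act: "x \<in> U \<Longrightarrow> log_partial j (poly_act p) x = poly_act ([:v $ j, m j:] * p) x"
proof (induction p arbitrary: x)
  case 0
  then show ?case by (simp add: log_partial_def cpartial_const)
next
  case (pCons a p)
  note holomorphic = holomorphic_sev_on_poly_act[of p]
    and slope_holomorphic = holomorphic_sev_on_slope[OF holomorphic_sev_on_poly_act[of p]]
  have "log_partial j (poly_act (pCons a p)) x =
      a * log_partial j f x + log_partial j (slope (poly_act p)) x"
    using log_partial_lincomb[OF f slope_holomorphic pCons.prems, of j a 1]
    by (simp add: poly_act_pCons)
  also have "log_partial j (slope (poly_act p)) x = slope (log_partial j (poly_act p)) x"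
    by (rule log_partial_slope_commute[OF holomorphic pCons.prems])
  also have "\<dots> = slope (\<lambda>y. v $ j * poly_act p y + m j * slope (poly_act p) y) x"
    using pCons.IH poly_act_linear_mult
    by (intro slope_cong[OF pCons.prems] holomorphic_sev_on_log_partial holomorphic U) metis
  also have "\<dots> = v $ j * slope (poly_act p) x + m j * slope (slope (poly_act p)) x"
    by (rule slope_lincomb[OF holomorphic slope_holomorphic pCons.prems])
  finally have "log_partial j (poly_act (pCons a p)) x = v $ j * (a * f x + slope (poly_act p) x) +
      m j * (a * slope f x + slope (slope (poly_act p)) x)"
    by (simp add: log_partial_slope[OF pCons.prems] algebra_simps)
  also have "\<dots> = v $ j * poly_act (pCons a p) x + m j * slope (poly_act (pCons a p)) x"
    using slope_lincomb[OF f slope_holomorphic pCons.prems, of a 1] by (simp add: poly_act_pCons)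
  finally show ?case by (simp only: poly_act_linear_mult[OF pCons.prems])
qed

definition annihilator :: "complex poly set" where
  "annihilator = {p. \<forall>x\<in>U. poly_act p x = 0}"

lemma annihilator_add: "p \<in> annihilator \<Longrightarrow> q \<in> annihilator \<Longrightarrow> p + q \<in> annihilator"
  by (simp add: annihilator_def poly_act_add)

lemma annihilator_pCons_0:
  assumes "p \<in> annihilator"
  shows "pCons 0 p \<in> annihilator"
  unfolding annihilator_def
proof (intro CollectI ballI)
  fix x assume "x \<in> U"
  then have "slope (poly_act p) x = slope (\<lambda>_. 0) x"
    using assms by (intro slope_cong holomorphic_sev_on_poly_act) (auto simp: annihilator_def)
  then show "poly_act (pCons 0 p) x = 0" by (simp add: poly_act_pCons slope_zero)
qed

lemma annihilator_mult: "p \<in> annihilator \<Longrightarrow> q * p \<in> annihilator"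
proof (induction q)
  case (pCons c q)
  have "smult c p \<in> annihilator" using pCons.prems by (simp add: annihilator_def poly_act_smult)
  then show ?case using annihilator_pCons_0 pCons by (simp add: mult_pCons_left annihilator_add)
qed (simp add: annihilator_def)

definition indicial :: "nat ^ 'n \<Rightarrow> complex poly" where
  "indicial u = falling_fact (\<lambda>j. [:v $ j, m j:]) u"

lemma poly_indicial: "poly (indicial u) z = falling_fact (\<lambda>j. v $ j + z * m j) u"
  by (simp add: indicial_def falling_fact_def poly_prod)

lemma vec_power_mult_multi_cpartial:
  "x \<in> U \<Longrightarrow> vec_power x u * multi_cpartial u f x = poly_act (indicial u) x"
proof (induction u arbitrary: x rule: nat_vec_add_axis_induct)
  case zero
  then show ?case
    by (simp add: indicial_def multi_cpartial_0[OF f U] one_pCons poly_act_pCons slope_zero)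
next
  case (add_axis u i)
  let ?h = "\<lambda>y. vec_power y u * multi_cpartial u f y"
  have "has_cgradient ?h (\<lambda>i. vec_power x u * cpartial i (multi_cpartial u f) x +
      of_nat (u $ i) * vec_power x (u - axis i 1) * multi_cpartial u f x) x"
    by (intro has_cgradient_mult has_cgradient_vec_power holomorphic_sev_on_imp_has_cgradient[OF
          holomorphic_sev_on_multi_cpartial[OF f U] add_axis.prems])
  then have "log_partial i ?h x = x $ i * (vec_power x u * cpartial i (multi_cpartial u f) x) +
      of_nat (u $ i) * vec_power x (u - axis i 1) * x $ i * multi_cpartial u f x"
    by (simp add: log_partial_def has_cgradient_imp_cpartial algebra_simps)
  then have "vec_power x (u + axis i 1) * multi_cpartial (u + axis i 1) f x =
      log_partial i ?h x - of_nat (u $ i) * ?h x"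
    unfolding vec_power_diff_axis_mult vec_power_add vec_power_axis
      multi_cpartial_add_axis[OF f U add_axis.prems] by (simp add: mult_ac)
  also have "log_partial i ?h x = poly_act ([:v $ i, m i:] * indicial u) x"
    unfolding log_partial_poly_act[OF add_axis.prems, symmetric] using add_axis.IH add_axis.prems
    by (intro log_partial_cong[OF U, symmetric] holomorphic_sev_on_poly_act) auto
  also have "\<dots> - of_nat (u $ i) * ?h x = poly_act ([:v $ i - of_nat (u $ i), m i:] * indicial u) x"
    unfolding poly_act_linear_mult[OF add_axis.prems] add_axis.IH[OF add_axis.prems]
    by (simp add: algebra_simps)
  finally show ?case
    unfolding indicial_def falling_fact_add_axis by (simp add: of_nat_poly)
qed

lemma indicial_in_annihilator: "(\<And>x. x \<in> U \<Longrightarrow> multi_cpartial u f x = 0) \<Longrightarrow> indicial u \<in> annihilator"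
  using vec_power_mult_multi_cpartial[of _ u] by (simp add: annihilator_def)

lemma zero_if_no_common_root:
  assumes "\<And>z. \<exists>p\<in>annihilator. poly p z \<noteq> 0" "x \<in> U"
  shows "f x = 0"
proof -
  have "1 \<in> annihilator" by (rule one_in_poly_ideal[OF annihilator_add annihilator_mult assms(1)])
  then show ?thesis
    using assms(2) by (simp add: annihilator_def one_pCons poly_act_pCons slope_zero)
qed

lemma homogeneous_if_simple_common_root:
  assumes nonzero: "\<And>z. z \<noteq> 0 \<Longrightarrow> \<exists>p\<in>annihilator. poly p z \<noteq> 0"
    and simple: "pCons 0 r \<in> annihilator" "poly r 0 \<noteq> 0" and x: "x \<in> U"
  shows "log_partial j f x = v $ j * f x"
proof -
  have "1 \<in> {p. pCons 0 p \<in> annihilator}"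
  proof (rule one_in_poly_ideal)
    show "p + q \<in> {p. pCons 0 p \<in> annihilator}"
      if "p \<in> {p. pCons 0 p \<in> annihilator}" "q \<in> {p. pCons 0 p \<in> annihilator}" for p q
      using that annihilator_add[of "pCons 0 p" "pCons 0 q"] by simp
    show "q * p \<in> {p. pCons 0 p \<in> annihilator}" if "p \<in> {p. pCons 0 p \<in> annihilator}" for p q
      using that annihilator_mult[of "pCons 0 p" q] by simp
    show "\<exists>p\<in>{p. pCons 0 p \<in> annihilator}. poly p z \<noteq> 0" for z
      using nonzero[of z] simple annihilator_pCons_0 by (cases "z = 0") auto
  qed
  then have "slope (poly_act 1) x = 0"
    using x by (simp add: annihilator_def poly_act_pCons)
  moreover have "poly_act 1 = f" by (simp add: fun_eq_iff one_pCons poly_act_pCons slope_zero)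
  ultimately show ?thesis using log_partial_slope[OF x, of j] by simp
qed

end

section \<open>Initial ideals and standard pairs\<close>

lemma wt_neg_axis: "wt (- axis i 1) u = - real (u $ i)"
proof -
  have "wt (- axis i 1) u = (\<Sum>j\<in>UNIV. if j = i then - real (u $ j) else 0)"
    unfolding wt_def by (rule sum.cong) (auto simp: axis_def)
  then show ?thesis by simp
qed

lemma lookup_initial_form:
  "Poly_Mapping.lookup (initial_form w f) a =
    (if \<forall>u'\<in>Poly_Mapping.keys f. wt w u' \<le> wt w a then Poly_Mapping.lookup f a else 0)"
proof -
  let ?K = "{u \<in> Poly_Mapping.keys f. \<forall>u'\<in>Poly_Mapping.keys f. wt w u' \<le> wt w u}"
  have "Poly_Mapping.lookup (initial_form w f) a =
      (\<Sum>u\<in>?K. if u = a then Poly_Mapping.lookup f u else 0)"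
    unfolding initial_form_def lookup_sum lookup_single when_def by simp
  also have "\<dots> = (if a \<in> ?K then Poly_Mapping.lookup f a else 0)"
    by (simp add: sum.delta')
  finally show ?thesis by (auto simp: in_keys_iff)
qed

lemma dmonom_mult: "dmonom a * dmonom b = dmonom (a + b)"
  by (simp add: dmonom_def mult_single)

lemma lookup_dmonom: "Poly_Mapping.lookup (dmonom a) b = (if a = b then 1 else 0)"
  by (simp add: dmonom_def lookup_single when_def)

lemma initial_form_dmonom: "initial_form w (dmonom a) = dmonom a"
  by (rule poly_mapping_eqI) (auto simp: lookup_initial_form dmonom_def lookup_single when_def)

lemma initial_form_binomial:
  assumes "wt w b < wt w a"
  shows "initial_form w (dmonom a - dmonom b) = dmonom a"
proof (rule poly_mapping_eqI)
  fix c
  have "a \<noteq> b" using assms by auto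
  then have "Poly_Mapping.keys (dmonom a - dmonom b) = {a, b}"
    by (auto simp: in_keys_iff lookup_minus lookup_dmonom split: if_splits)
  then show "Poly_Mapping.lookup (initial_form w (dmonom a - dmonom b)) c =
      Poly_Mapping.lookup (dmonom a) c"
    using assms \<open>a \<noteq> b\<close> by (auto simp: lookup_initial_form lookup_minus lookup_dmonom)
qed

lemma dmonom_in_initial_ideal: "dmonom a \<in> I \<Longrightarrow> dmonom a \<in> initial_ideal w I"
  unfolding initial_ideal_def by (rule ideal_gen_base) (metis imageI initial_form_dmonom)

lemma dmonom_in_initial_ideal_toric_ideal:
  assumes weight: "admissible_weight A i w'"
    and fibre: "A *v int_vec a = A *v int_vec b" and less: "a $ i < b $ i"
  shows "dmonom a \<in> initial_ideal w' (toric_ideal A)"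
proof -
  let ?J = "initial_ideal (- axis i 1) (toric_ideal A)"
  have "initial_form (- axis i 1) (dmonom a - dmonom b) = dmonom a"
    using less by (intro initial_form_binomial) (simp add: wt_neg_axis)
  then have unperturbed: "dmonom a \<in> ?J"
    unfolding initial_ideal_def using toric_ideal_binomial[OF fibre]
    by (metis ideal_gen_base imageI)
  then show ?thesis
    using weight dmonom_in_initial_ideal[OF unperturbed]
    by (auto simp: admissible_weight_def Let_def split: if_splits)
qed

lemma lookup_ideal_gen_eq_0:
  fixes S :: "'n::finite dpoly set"
  assumes divisor_closed: "\<And>b c. c + b \<in> T \<Longrightarrow> b \<in> T"
    and generators: "\<And>s a. s \<in> S \<Longrightarrow> a \<in> T \<Longrightarrow> Poly_Mapping.lookup s a = 0"
    and p: "p \<in> ideal_gen S"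
  shows "a \<in> T \<Longrightarrow> Poly_Mapping.lookup p a = 0"
  using p
proof (induction arbitrary: a rule: ideal_gen_induct)
  case (mult r s)
  show ?case
  proof (rule ccontr)
    assume "Poly_Mapping.lookup (r * s) a \<noteq> 0"
    then obtain c b where "a = c + b" "b \<in> Poly_Mapping.keys s"
      using keys_mult[of r s] by (auto simp: in_keys_iff subset_iff)
    then show False
      using divisor_closed mult.prems generators[OF mult.hyps] by (auto simp: in_keys_iff)
  qed
qed (simp_all add: lookup_add)

definition isolated_monomials :: "int ^ 'n::finite ^ 'd::finite \<Rightarrow> (nat ^ 'n) set" where
  "isolated_monomials A = {a. \<forall>b. A *v int_vec b = A *v int_vec a \<longrightarrow> b = a}"

lemma isolated_monomials_divisor:
  assumes "c + b \<in> isolated_monomials A"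
  shows "b \<in> isolated_monomials A"
  unfolding isolated_monomials_def
proof (intro CollectI allI impI)
  fix b' assume "A *v int_vec b' = A *v int_vec b"
  then have "A *v int_vec (c + b') = A *v int_vec (c + b)"
    by (simp add: int_vec_add matrix_vector_right_distrib)
  then show "b' = b" using assms by (auto simp: isolated_monomials_def)
qed

lemma isolated_monomial_notin_initial_ideal:
  assumes a: "a \<in> isolated_monomials A"
  shows "dmonom a \<notin> initial_ideal w (toric_ideal A)"
proof -
  have toric: "Poly_Mapping.lookup p b = 0"
    if "p \<in> toric_ideal A" "b \<in> isolated_monomials A" for p b
    using isolated_monomials_divisor _ that[unfolded toric_ideal_def]
    by (rule lookup_ideal_gen_eq_0)
      (auto simp: isolated_monomials_def int_vec_def lookup_minus lookup_dmonom)
  have "Poly_Mapping.lookup p a = 0" if "p \<in> initial_ideal w (toric_ideal A)" for p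
    using isolated_monomials_divisor _ that[unfolded initial_ideal_def] a
    by (rule lookup_ideal_gen_eq_0) (auto simp: lookup_initial_form toric)
  then show ?thesis using lookup_dmonom[of a a] by fastforce
qed

lemma standard_pair_exists:
  fixes \<eta> :: "nat ^ 'n::finite"
  assumes ideal: "\<And>r s. s \<in> M \<Longrightarrow> r * s \<in> M"
    and notin: "\<And>\<mu>. (\<forall>i. i \<notin> \<tau> \<longrightarrow> \<mu> $ i = \<eta> $ i) \<Longrightarrow> dmonom \<mu> \<notin> M"
  shows "\<exists>\<eta>' \<sigma>. standard_pair M \<eta>' \<sigma> \<and> \<tau> \<subseteq> \<sigma> \<and> (\<forall>i. i \<notin> \<sigma> \<longrightarrow> \<eta>' $ i = \<eta> $ i)"
proof -
  define C where "C = {\<sigma>. \<tau> \<subseteq> \<sigma> \<and> (\<forall>\<mu>. (\<forall>i. i \<notin> \<sigma> \<longrightarrow> \<mu> $ i = \<eta> $ i) \<longrightarrow> dmonom \<mu> \<notin> M)}"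
  have "\<tau> \<in> C" using notin by (simp add: C_def)
  then obtain \<sigma> where \<sigma>: "\<sigma> \<in> C" and maximal: "\<And>\<rho>. \<rho> \<in> C \<Longrightarrow> \<sigma> \<subseteq> \<rho> \<Longrightarrow> \<rho> = \<sigma>"
    using finite_has_maximal2[of C \<tau>] by auto
  define \<eta>' where "\<eta>' = (\<chi> i. if i \<in> \<sigma> then 0 else \<eta> $ i)"
  have "standard_pair M \<eta>' \<sigma>"
    unfolding standard_pair_def
  proof (intro conjI allI impI ballI)
    fix i assume "i \<in> \<sigma>" then show "\<eta>' $ i = 0" by (simp add: \<eta>'_def)
  next
    fix \<mu> :: "nat ^ 'n" assume "\<forall>i. i \<notin> \<sigma> \<longrightarrow> \<mu> $ i = 0"
    then show "dmonom (\<eta>' + \<mu>) \<notin> M" using \<sigma> by (simp add: C_def \<eta>'_def)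
  next
    fix l assume l: "l \<notin> \<sigma>"
    then have "insert l \<sigma> \<notin> C" using maximal by blast
    then obtain \<mu> where \<mu>: "\<forall>i. i \<notin> insert l \<sigma> \<longrightarrow> \<mu> $ i = \<eta> $ i" "dmonom \<mu> \<in> M"
      using \<sigma> by (auto simp: C_def)
    define \<nu> where "\<nu> = (\<chi> i. if i \<in> insert l \<sigma> then \<mu> $ i else 0)"
    have "\<eta>' + \<nu> = axis l (\<eta> $ l) + \<mu>"
      using \<mu>(1) l by (auto simp: vec_eq_iff \<eta>'_def \<nu>_def axis_def)
    then have "dmonom (\<eta>' + \<nu>) \<in> M"
      using ideal[OF \<mu>(2), of "dmonom (axis l (\<eta> $ l))"] by (simp add: dmonom_mult)
    then show "\<exists>\<mu>. (\<forall>i. i \<notin> insert l \<sigma> \<longrightarrow> \<mu> $ i = 0) \<and> dmonom (\<eta>' + \<mu>) \<in> M"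
      by (intro exI[of _ \<nu>]) (auto simp: \<nu>_def)
  qed
  then show ?thesis using \<sigma> by (intro exI[of _ \<eta>'] exI[of _ \<sigma>]) (auto simp: C_def \<eta>'_def)
qed

lemma standard_pair_less_kernel_vector:
  assumes weight: "admissible_weight A i w'"
    and pair: "standard_pair (initial_ideal w' (toric_ideal A)) \<eta> \<sigma>"
    and y: "A *v y = 0" "y $ i < 0"
  shows "\<exists>j. j \<notin> \<sigma> \<and> int (\<eta> $ j) < y $ j"
proof (rule ccontr)
  assume "\<not> ?thesis"
  then have y_le: "\<And>j. j \<notin> \<sigma> \<Longrightarrow> y $ j \<le> int (\<eta> $ j)" by force
  define \<mu> where "\<mu> = (\<chi> j. if j \<in> \<sigma> then nat \<bar>y $ j\<bar> else 0)"
  define b where "b = (\<chi> j. nat (int ((\<eta> + \<mu>) $ j) - y $ j))"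
  have "int_vec b = int_vec (\<eta> + \<mu>) - y"
    using y_le by (auto simp: vec_eq_iff b_def \<mu>_def)
  then have "A *v int_vec (\<eta> + \<mu>) = A *v int_vec b"
    by (simp add: matrix_vector_mult_diff_distrib y)
  moreover have "(\<eta> + \<mu>) $ i < b $ i"
    using y(2) by (simp add: b_def)
  ultimately have "dmonom (\<eta> + \<mu>) \<in> initial_ideal w' (toric_ideal A)"
    by (rule dmonom_in_initial_ideal_toric_ideal[OF weight])
  then show False using pair by (auto simp: standard_pair_def \<mu>_def)
qed

section \<open>Exponents and kernel vectors\<close>

text \<open>A descent moves \<open>u\<close> to \<open>u - y\<close>, which lowers the weight \<open>- e\<^sub>i\<close> and keeps the natural
  coordinates of \<open>u\<close> natural.\<close>

definition has_descent :: "int ^ 'n::finite ^ 'd::finite \<Rightarrow> 'n \<Rightarrow> complex ^ 'n \<Rightarrow> bool" where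
  "has_descent A i u \<longleftrightarrow>
     (\<exists>y. A *v y = 0 \<and> y $ i < 0 \<and> (\<forall>j n. u $ j = of_nat n \<longrightarrow> y $ j \<le> int n))"

definition isolated_exponent :: "int ^ 'n::finite ^ 'd::finite \<Rightarrow> complex ^ 'n \<Rightarrow> bool" where
  "isolated_exponent A u \<longleftrightarrow>
     (\<forall>y. A *v y = 0 \<longrightarrow> y \<noteq> 0 \<longrightarrow> (\<exists>j n. u $ j = of_nat n \<and> int n < y $ j))"

lemma fake_exponent_imp_no_descent:
  assumes "admissible_weight A i w'" "fake_exponent A \<gamma> w' u"
  shows "\<not> has_descent A i u"
proof
  assume "has_descent A i u"
  then obtain y where y: "A *v y = 0" "y $ i < 0" and y_le: "\<And>j n. u $ j = of_nat n \<Longrightarrow> y $ j \<le> int n"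
    by (auto simp: has_descent_def)
  obtain \<eta> \<sigma> where pair: "standard_pair (initial_ideal w' (toric_ideal A)) \<eta> \<sigma>"
    and u: "\<And>j. j \<notin> \<sigma> \<Longrightarrow> u $ j = of_nat (\<eta> $ j)"
    using assms(2) by (auto simp: fake_exponent_def)
  obtain j where "j \<notin> \<sigma>" "int (\<eta> $ j) < y $ j"
    using standard_pair_less_kernel_vector[OF assms(1) pair y] by blast
  then show False using y_le[OF u] by force
qed

lemma isolated_exponent_imp_fake_exponent:
  fixes A :: "int ^ 'n::finite ^ 'd::finite"
  assumes u: "isolated_exponent A u"
  shows "fake_exponent A (complex_mat A *v u) w u"
proof -
  let ?M = "initial_ideal w (toric_ideal A)"
  define N where "N = {j. \<exists>n. u $ j = of_nat n}"
  define \<eta> :: "nat ^ 'n" where "\<eta> = (\<chi> j. SOME n. u $ j = of_nat n)"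
  have \<eta>: "u $ j = of_nat (\<eta> $ j)" if "j \<in> N" for j
    using that someI_ex[of "\<lambda>n. u $ j = of_nat n"] by (simp add: N_def \<eta>_def)
  have isolated: "\<mu> \<in> isolated_monomials A" if \<mu>: "\<And>j. j \<in> N \<Longrightarrow> \<mu> $ j = \<eta> $ j" for \<mu>
    unfolding isolated_monomials_def
  proof (intro CollectI allI impI, rule ccontr)
    fix b assume "A *v int_vec b = A *v int_vec \<mu>" "b \<noteq> \<mu>"
    then have "A *v (int_vec \<mu> - int_vec b) = 0" "int_vec \<mu> - int_vec b \<noteq> 0"
      by (simp_all add: matrix_vector_mult_diff_distrib int_vec_eq_iff)
    then obtain j n where j: "u $ j = of_nat n" "int n < int (\<mu> $ j) - int (b $ j)"
      using u by (fastforce simp: isolated_exponent_def)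
    then have "j \<in> N" by (auto simp: N_def)
    from \<mu>[OF this] \<eta>[OF this] show False using j by simp
  qed
  have "r * s \<in> ?M" if "s \<in> ?M" for r s
    using that unfolding initial_ideal_def by (rule ideal_gen_mult)
  moreover have "dmonom \<mu> \<notin> ?M" if "\<forall>j. j \<notin> - N \<longrightarrow> \<mu> $ j = \<eta> $ j" for \<mu>
    using that by (intro isolated_monomial_notin_initial_ideal isolated) simp
  ultimately have "\<exists>\<eta>' \<sigma>. standard_pair ?M \<eta>' \<sigma> \<and> - N \<subseteq> \<sigma> \<and> (\<forall>j. j \<notin> \<sigma> \<longrightarrow> \<eta>' $ j = \<eta> $ j)"
    by (rule standard_pair_exists)
  then obtain \<eta>' \<sigma> where "standard_pair ?M \<eta>' \<sigma>" "- N \<subseteq> \<sigma>" "\<And>j. j \<notin> \<sigma> \<Longrightarrow> \<eta>' $ j = \<eta> $ j"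
    by blast
  moreover from this have "u $ j = of_nat (\<eta>' $ j)" if "j \<notin> \<sigma>" for j
    using that \<eta>[of j] by auto
  ultimately show ?thesis
    unfolding fake_exponent_def by blast
qed

lemma isolated_exponent_imp_min_neg_support:
  assumes u: "isolated_exponent A u"
  shows "min_neg_support A u"
  unfolding min_neg_support_def
proof (intro allI impI)
  fix y assume y: "A *v y = 0" and subset: "nsupp (u + complex_vec y) \<subseteq> nsupp u"
  have "y = 0"
  proof (rule ccontr)
    assume "y \<noteq> 0"
    moreover have "A *v (- y) = 0"
      using matrix_vector_mult_diff_distrib[of A 0 y] y by simp
    ultimately obtain j n where j: "u $ j = of_nat n" "int n < - y $ j"
      using u by (fastforce simp: isolated_exponent_def)
    then have "(u + complex_vec y) $ j = of_int (int n + y $ j)" "int n + y $ j < 0"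
      by (simp_all add: complex_vec_def)
    then have "j \<in> nsupp u" using subset unfolding nsupp_def by blast
    then obtain k where "k < 0" "of_int k = (of_int (int n) :: complex)"
      using j(1) by (auto simp: nsupp_def)
    then show False by (simp only: of_int_eq_iff)
  qed
  then show "nsupp (u + complex_vec y) = nsupp u"
    by (simp add: complex_vec_def vec_eq_iff nsupp_def)
qed

lemma isolated_exponent_imp_toric_solution:
  assumes u: "isolated_exponent A u" and L: "log_branches U L" and U: "open U"
  shows "toric_solution U A (cmonomial_on U L u)"
  unfolding toric_solution_def
proof (intro allI impI ballI)
  fix a b x assume fibre: "A *v int_vec a = A *v int_vec b" and x: "x \<in> U"
  have vanishes: "multi_cpartial a (cmonomial_on U L u) x = 0"
    if collision: "A *v int_vec a = A *v int_vec b" "a \<noteq> b" for a b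
  proof -
    have "A *v (int_vec a - int_vec b) = 0" "int_vec a - int_vec b \<noteq> 0"
      using collision by (simp_all add: matrix_vector_mult_diff_distrib int_vec_eq_iff)
    then obtain j n where "u $ j = of_nat n" "int n < int (a $ j) - int (b $ j)"
      using u by (fastforce simp: isolated_exponent_def)
    then have "falling_fact (($) u) a = 0"
      unfolding falling_fact_eq_0_iff by (intro exI[of _ j] exI[of _ n]) auto
    then show ?thesis by (simp add: multi_cpartial_cmonomial_on[OF L U x])
  qed
  show "multi_cpartial a (cmonomial_on U L u) x = multi_cpartial b (cmonomial_on U L u) x"
    using vanishes[OF fibre] vanishes[OF fibre[symmetric]] by (cases "a = b") auto
qed

lemma toric_solution_pos_part_annihilates:
  assumes f: "holomorphic_sev_on f U" and U: "open U" and toric: "toric_solution U A f"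
    and independent: "\<And>x. x \<in> U \<Longrightarrow> cpartial i f x = 0"
    and y: "A *v y = 0" "y $ i < 0" and x: "x \<in> U"
  shows "multi_cpartial (\<chi> j. nat (y $ j)) f x = 0"
proof -
  define b where "b = (\<chi> j. nat (- y $ j))"
  have "int_vec (\<chi> j. nat (y $ j)) - int_vec b = y" by (simp add: vec_eq_iff b_def)
  then have "A *v int_vec (\<chi> j. nat (y $ j)) = A *v int_vec b"
    using y(1) by (metis eq_iff_diff_eq_0 matrix_vector_mult_diff_distrib)
  then have "multi_cpartial (\<chi> j. nat (y $ j)) f x = multi_cpartial b f x"
    using toric x unfolding toric_solution_def by blast
  also have "b = (b - axis i 1) + axis i 1"
    using y(2) by (auto simp: vec_eq_iff b_def axis_def)
  also have "multi_cpartial \<dots> f x = multi_cpartial (b - axis i 1) (cpartial i f) x"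
    by (rule multi_cpartial_cpartial[OF f U x, symmetric])
  also have "\<dots> = multi_cpartial (b - axis i 1) (\<lambda>_. 0) x"
    using holomorphic_sev_on_cpartial[OF f U] U independent x by (rule multi_cpartial_cong)
  finally show ?thesis by (simp add: multi_cpartial_zero_fun)
qed

lemma (in log_line) nonroot_if_has_descent:
  assumes toric: "toric_solution U A f" and independent: "\<And>x. x \<in> U \<Longrightarrow> cpartial i f x = 0"
    and descent: "has_descent A i (\<chi> j. v $ j + s * m j)"
  shows "\<exists>p\<in>annihilator. poly p s \<noteq> 0"
proof -
  obtain y where y: "A *v y = 0" "y $ i < 0"
    and y_le: "\<And>j n. v $ j + s * m j = of_nat n \<Longrightarrow> y $ j \<le> int n"
    using descent by (auto simp: has_descent_def)
  have "indicial (\<chi> j. nat (y $ j)) \<in> annihilator"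
    by (intro indicial_in_annihilator
        toric_solution_pos_part_annihilates[OF f U toric independent y])
  moreover have "poly (indicial (\<chi> j. nat (y $ j))) s \<noteq> 0"
    unfolding poly_indicial falling_fact_eq_0_iff using y_le by force
  ultimately show ?thesis by blast
qed

lemma (in log_line) indicial_add_axis:
  assumes "v $ j = of_nat (u $ j)"
  shows "indicial (u + axis j 1) = pCons 0 (smult (m j) (indicial u))"
  using assms unfolding indicial_def falling_fact_add_axis by (simp add: of_nat_poly)

subsection \<open>Complex kernel vectors of integer matrices\<close>

lemma ex_common_denominator:
  fixes q :: "'n::finite \<Rightarrow> rat"
  shows "\<exists>N p. N \<noteq> 0 \<and> (\<forall>j. q j = of_int (p j) / of_int (N::int))"
proof -
  define d where "d j = snd (quotient_of (q j))" for j
  have denominator: "d j > 0" "q j = of_int (fst (quotient_of (q j))) / of_int (d j)" for j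
    using quotient_of_denom_pos'[of "q j"] quotient_of_div[of "q j", OF prod.collapse[symmetric]]
    by (simp_all add: d_def)
  define N p where "N = (\<Prod>k\<in>UNIV. d k)"
    and "p j = fst (quotient_of (q j)) * (\<Prod>k\<in>UNIV - {j}. d k)" for j
  have "N \<noteq> 0"
    using denominator(1) by (simp add: N_def less_imp_neq[symmetric])
  moreover have "q j = of_int (p j) / of_int N" for j
  proof -
    have "N = d j * (\<Prod>k\<in>UNIV - {j}. d k)"
      unfolding N_def by (rule prod.remove) auto
    with \<open>N \<noteq> 0\<close> show ?thesis using denominator(2)[of j] by (simp add: p_def)
  qed
  ultimately show ?thesis by (intro exI[of _ N] exI[of _ p]) simp
qed

lemma rational_kernel_vector:
  fixes A :: "int ^ 'n::finite ^ 'd::finite" and B :: "int ^ 'k::finite ^ 'n"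
  assumes kernel: "\<And>y. A *v y = 0 \<Longrightarrow> y \<in> range ((*v) B)"
    and q: "\<And>i. (\<Sum>j\<in>UNIV. of_int (A $ i $ j) * q j) = (0::rat)"
  shows "\<exists>c. \<forall>j. of_rat (q j) = (complex_mat B *v c) $ j"
proof -
  obtain N p where N: "N \<noteq> 0" and p: "\<And>j. q j = of_int (p j) / of_int (N::int)"
    using ex_common_denominator by metis
  have "(\<Sum>j\<in>UNIV. A $ i $ j * p j) = 0" for i
  proof -
    have "of_int (\<Sum>j\<in>UNIV. A $ i $ j * p j) = of_int N * (\<Sum>j\<in>UNIV. of_int (A $ i $ j) * q j)"
      using N by (simp add: p sum_distrib_left)
    then show ?thesis by (simp only: q mult_zero_right of_int_eq_0_iff)
  qed
  then have "A *v (\<chi> j. p j) = 0"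
    by (simp add: matrix_vector_mult_def vec_eq_iff)
  then obtain z where "(\<chi> j. p j) = B *v z" using kernel by blast
  then have p_eq: "p j = (\<Sum>k\<in>UNIV. B $ j $ k * z $ k)" for j
    by (simp add: vec_eq_iff matrix_vector_mult_def)
  have "of_rat (q j) = (complex_mat B *v (\<chi> k. of_int (z $ k) / of_int N)) $ j" for j
    by (simp add: p p_eq complex_mat_mult_nth of_rat_divide
        of_rat_mult of_rat_sum sum_divide_distrib)
  then show ?thesis by blast
qed

lemma complex_vec_rational_components:
  fixes y :: "complex ^ 'n::finite" and A :: "int ^ 'n ^ 'd::finite"
  assumes y: "complex_mat A *v y = 0"
  obtains S and q :: "complex \<Rightarrow> 'n \<Rightarrow> rat" where "finite S"
    and "\<And>j. y $ j = (\<Sum>b\<in>S. of_rat (q b j) * b)"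
    and "\<And>b i. (\<Sum>j\<in>UNIV. of_int (A $ i $ j) * q b j) = 0"
proof -
  interpret Q: vector_space "\<lambda>(r::rat) (z::complex). of_rat r * z"
    by unfold_locales (simp_all add: algebra_simps of_rat_add of_rat_mult)
  define basis where "basis = Q.extend_basis {}"
  have independent: "Q.independent basis" and span: "z \<in> Q.span basis" for z
    using Q.independent_extend_basis[of "{}"] Q.span_extend_basis[of "{}"]
    by (simp_all add: basis_def Q.independent_empty)
  define q where "q b j = Q.representation basis (y $ j) b" for b j
  define S where "S = (\<Union>j. {b. q b j \<noteq> 0})"
  have finite: "finite S"
    unfolding S_def q_def by (intro finite_UN_I Q.finite_representation) simp
  have "(\<Sum>b\<in>S. of_rat (q b j) * b) = y $ j" for j
  proof -
    have "{b. q b j \<noteq> 0} \<subseteq> S" by (auto simp: S_def)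
    then have "(\<Sum>b\<in>S. of_rat (q b j) * b) = (\<Sum>b | q b j \<noteq> 0. of_rat (q b j) * b)"
      using finite by (intro sum.mono_neutral_right) auto
    then show ?thesis
      using Q.sum_nonzero_representation_eq[OF independent span] by (simp add: q_def)
  qed
  moreover have "(\<Sum>j\<in>UNIV. of_int (A $ i $ j) * q b j) = 0" for b i
  proof -
    have "(\<Sum>j\<in>UNIV. of_rat (of_int (A $ i $ j)) * y $ j) = 0"
      using y by (simp add: vec_eq_iff complex_mat_mult_nth)
    then have "Q.representation basis (\<Sum>j\<in>UNIV. of_rat (of_int (A $ i $ j)) * y $ j) b = 0"
      by (simp add: Q.representation_zero)
    then show ?thesis
      by (simp only: Q.representation_sum[OF independent span]
          Q.representation_scale[OF independent span] q_def)
  qed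
  ultimately show thesis
    by (intro that[OF finite, of q]) simp_all
qed

lemma complex_kernel_vector:
  fixes A :: "int ^ 'n::finite ^ 'd::finite" and B :: "int ^ 'k::finite ^ 'n"
  assumes kernel: "\<And>y. A *v y = 0 \<Longrightarrow> y \<in> range ((*v) B)" and y: "complex_mat A *v y = 0"
  shows "\<exists>c. y = complex_mat B *v c"
proof -
  obtain S and q :: "complex \<Rightarrow> 'n \<Rightarrow> rat" where "finite S"
    and y_eq: "\<And>j. y $ j = (\<Sum>b\<in>S. of_rat (q b j) * b)"
    and q: "\<And>b i. (\<Sum>j\<in>UNIV. of_int (A $ i $ j) * q b j) = 0"
    by (rule complex_vec_rational_components[OF y]) blast
  have "\<exists>c. \<forall>j. of_rat (q b j) = (complex_mat B *v c) $ j" for b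
    by (rule rational_kernel_vector[OF kernel q])
  then obtain c where c: "\<And>b j. of_rat (q b j) = (complex_mat B *v c b) $ j"
    by metis
  have "y $ j = (complex_mat B *v (\<Sum>b\<in>S. b *s c b)) $ j" for j
  proof -
    have "y $ j = (\<Sum>b\<in>S. \<Sum>k\<in>UNIV. of_int (B $ j $ k) * (b * c b $ k))"
      by (simp add: y_eq c complex_mat_mult_nth sum_distrib_left mult_ac)
    also have "\<dots> = (\<Sum>k\<in>UNIV. \<Sum>b\<in>S. of_int (B $ j $ k) * (b * c b $ k))"
      by (rule sum.swap)
    finally show ?thesis by (simp add: complex_mat_mult_nth sum_distrib_left)
  qed
  then show ?thesis by (metis vec_eq_iff)
qed

section \<open>Exponents in codimension two\<close>

lemma
  assumes F: "complex_subfield F"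
  shows complex_subfield_diff: "x \<in> F \<Longrightarrow> y \<in> F \<Longrightarrow> x - y \<in> F"
    and complex_subfield_mult: "x \<in> F \<Longrightarrow> y \<in> F \<Longrightarrow> x * y \<in> F"
    and complex_subfield_divide: "x \<in> F \<Longrightarrow> y \<in> F \<Longrightarrow> x / y \<in> F"
  using F by (auto simp: complex_subfield_def divide_inverse)

lemma complex_subfield_of_int:
  assumes F: "complex_subfield F"
  shows "of_int k \<in> F"
proof -
  have zero: "0 \<in> F" and one: "1 \<in> F"
    using F by (auto simp: complex_subfield_def)
  have "x + y \<in> F" if "x \<in> F" "y \<in> F" for x y
    using complex_subfield_diff[OF F that(1) complex_subfield_diff[OF F zero that(2)]] by simp
  then show ?thesis
    by (induction k rule: int_induct[of _ 0]) (auto simp: zero one complex_subfield_diff[OF F])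
qed

locale gale_dual =
  fixes A :: "int ^ 'n::finite ^ 'd::finite"
    and B :: "int ^ 2 ^ 'n"
    and i1 i2 i3 i4 :: 'n
    and \<alpha> :: "'n \<Rightarrow> complex"
    and v :: "complex ^ 'n"
  assumes basis_B: "bij_betw (\<lambda>z :: int ^ 2. B *v z) UNIV {u. A *v u = 0}"
    and idx: "distinct [i1, i2, i3, i4]"
    and row1: "B $ i1 $ 1 > 0" "B $ i1 $ 2 > 0"
    and row2: "B $ i2 $ 1 < 0" "B $ i2 $ 2 > 0"
    and row3: "B $ i3 $ 1 < 0" "B $ i3 $ 2 < 0"
    and row4: "B $ i4 $ 1 > 0" "B $ i4 $ 2 < 0"
    and \<alpha>_irrational: "\<And>i. i \<notin> {i1, i2, i3, i4} \<Longrightarrow> \<alpha> i \<notin> \<rat>"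
    and \<alpha>_generic: "\<And>i. i \<notin> {i1, i2, i3, i4} \<Longrightarrow>
      \<alpha> i \<notin> rat_adjoin (\<alpha> ` (UNIV - {i1, i2, i3, i4, i}))"
    and v_def: "v = complex_vec (pos_part (column 1 B) + pos_part (column 2 B))
      - axis i1 1 - axis i2 1 - axis i4 1 + (\<Sum>i \<in> UNIV - {i1, i2, i3, i4}. axis i (\<alpha> i))"
begin

lemma B_mult_nth: "(B *v z) $ j = B $ j $ 1 * z $ 1 + B $ j $ 2 * z $ 2"
  by (simp add: matrix_vector_mult_def sum_2)

lemma kernel_eq_range: "A *v y = 0 \<longleftrightarrow> y \<in> range ((*v) B)"
  using basis_B by (auto simp: bij_betw_def)

lemma v_nth:
  "v $ i1 = of_int (B $ i1 $ 1 + B $ i1 $ 2 - 1)" "v $ i2 = of_int (B $ i2 $ 2 - 1)"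
  "v $ i3 = 0" "v $ i4 = of_int (B $ i4 $ 1 - 1)"
  "j \<notin> {i1, i2, i3, i4} \<Longrightarrow> \<exists>k. v $ j = of_int k + \<alpha> j"
proof -
  define S where "S = (\<Sum>i \<in> UNIV - {i1, i2, i3, i4}. axis i (\<alpha> i))"
  have S: "S $ j = (if j \<in> {i1, i2, i3, i4} then 0 else \<alpha> j)" for j
  proof -
    have "S $ j = (\<Sum>i \<in> UNIV - {i1, i2, i3, i4}. if i = j then \<alpha> i else 0)"
      unfolding S_def sum_component by (rule sum.cong) (auto simp: axis_def)
    then show ?thesis by simp
  qed
  show "v $ i1 = of_int (B $ i1 $ 1 + B $ i1 $ 2 - 1)" "v $ i2 = of_int (B $ i2 $ 2 - 1)"
    "v $ i3 = 0" "v $ i4 = of_int (B $ i4 $ 1 - 1)"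
    using idx row1 row2 row3 row4 unfolding v_def S_def[symmetric]
    by (auto simp: complex_vec_def pos_part_def column_def axis_def S)
  assume j: "j \<notin> {i1, i2, i3, i4}"
  then have "v $ j = of_int ((pos_part (column 1 B) + pos_part (column 2 B)) $ j) + \<alpha> j"
    unfolding v_def S_def[symmetric] by (auto simp: complex_vec_def axis_def S)
  then show "\<exists>k. v $ j = of_int k + \<alpha> j" by blast
qed

lemma v_integer: "j \<in> {i1, i2, i3, i4} \<Longrightarrow> \<exists>l. v $ j = of_int l"
  using v_nth(1-4) by (metis insertE of_int_0 singletonD)

text \<open>\<open>direction\<close> spans the kernel vectors of \<open>A\<close> over \<open>\<rat>\<close> that vanish at \<open>i3\<close>.\<close>

definition direction :: "'n \<Rightarrow> int" where
  "direction j = B $ j $ 1 * B $ i3 $ 2 - B $ j $ 2 * B $ i3 $ 1"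

lemma direction_signs: "direction i2 > 0" "direction i4 < 0" "direction i3 = 0"
proof -
  show "direction i2 > 0"
    using mult_neg_neg[OF row2(1) row3(2)] mult_pos_neg[OF row2(2) row3(1)]
    by (simp add: direction_def)
  show "direction i4 < 0"
    using mult_pos_neg[OF row4(1) row3(2)] mult_neg_neg[OF row4(2) row3(1)]
    by (simp add: direction_def)
qed (simp add: direction_def)

definition exponent_line :: "complex \<Rightarrow> complex ^ 'n" where
  "exponent_line t = (\<chi> j. v $ j + t * of_int (direction j))"

lemma exponent_line_0: "exponent_line 0 = v"
  by (simp add: exponent_line_def vec_eq_iff)

lemma complex_kernel_vector_level:
  assumes y: "complex_mat A *v y = 0" "y $ i3 = 0"
  shows "\<exists>t. \<forall>j. y $ j = t * of_int (direction j)"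
proof -
  obtain c where "y = complex_mat B *v c"
    using complex_kernel_vector[OF _ y(1)] kernel_eq_range by blast
  then have y_nth: "y $ j = of_int (B $ j $ 1) * c $ 1 + of_int (B $ j $ 2) * c $ 2" for j
    by (simp add: complex_mat_mult_nth sum_2)
  have nonzero: "of_int (B $ i3 $ 2) \<noteq> (0::complex)" using row3 by simp
  have "y $ j * of_int (B $ i3 $ 2) =
      c $ 1 * of_int (direction j) + of_int (B $ j $ 2) * y $ i3" for j
    by (simp add: y_nth direction_def algebra_simps)
  then have "y $ j = c $ 1 / of_int (B $ i3 $ 2) * of_int (direction j)" for j
    using nonzero y(2) by (simp add: field_simps)
  then show ?thesis by blast
qed

lemma has_descentI:
  assumes "B $ i3 $ 1 * z1 + B $ i3 $ 2 * z2 < 0"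
    and "\<And>j n. u $ j = of_nat n \<Longrightarrow> B $ j $ 1 * z1 + B $ j $ 2 * z2 \<le> int n"
  shows "has_descent A i3 u"
  unfolding has_descent_def
  using assms kernel_eq_range by (intro exI[of _ "B *v vector [z1, z2]"]) (simp add: B_mult_nth)

subsection \<open>Descents from irrational points of the line\<close>

lemma exponent_line_natural_outside:
  assumes i: "i \<notin> {i1, i2, i3, i4}" and n: "exponent_line t $ i = of_nat n"
  shows "t \<notin> \<rat>" "direction i \<noteq> 0"
proof -
  obtain k where "v $ i = of_int k + \<alpha> i" using v_nth(5)[OF i] by blast
  then have \<alpha>: "\<alpha> i = of_nat n - of_int k - t * of_int (direction i)"
    using n by (simp add: exponent_line_def algebra_simps)
  then show "t \<notin> \<rat>" using \<alpha>_irrational[OF i] by auto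
  show "direction i \<noteq> 0" using \<alpha> \<alpha>_irrational[OF i] by auto
qed

lemma exponent_line_natural_outside_unique:
  assumes i: "i \<notin> {i1, i2, i3, i4}" "exponent_line t $ i = of_nat n"
    and j: "j \<notin> {i1, i2, i3, i4}" "exponent_line t $ j = of_nat n'"
  shows "i = j"
proof (rule ccontr)
  assume "i \<noteq> j"
  obtain k where k: "v $ i = of_int k + \<alpha> i" using v_nth(5)[OF i(1)] by blast
  obtain l where l: "v $ j = of_int l + \<alpha> j" using v_nth(5)[OF j(1)] by blast
  have t: "t = (of_int (int n' - l) - \<alpha> j) / of_int (direction j)"
    using j(2) exponent_line_natural_outside(2)[OF j] by (simp add: exponent_line_def l field_simps)
  have \<alpha>: "\<alpha> i = of_int (int n - k) - t * of_int (direction i)"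
    using i(2) by (simp add: exponent_line_def k algebra_simps)
  have "\<alpha> i \<in> F" if F: "complex_subfield F" "\<alpha> ` (UNIV - {i1, i2, i3, i4, i}) \<subseteq> F" for F
  proof -
    have "\<alpha> j \<in> F" using F(2) j(1) \<open>i \<noteq> j\<close> by auto
    then show ?thesis
      unfolding \<alpha> t by (intro complex_subfield_diff complex_subfield_mult complex_subfield_divide
          complex_subfield_of_int F(1))
  qed
  then show False using \<alpha>_generic[OF i(1)] by (auto simp: rat_adjoin_def)
qed

lemma exponent_line_natural_irrational:
  assumes t: "t \<notin> \<rat>" and j: "j \<in> {i1, i2, i3, i4}" and n: "exponent_line t $ j = of_nat n"
  shows "direction j = 0" "B $ j $ 1 \<le> int n"
proof -
  obtain l where l: "v $ j = of_int l" using v_integer[OF j] by blast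
  show level: "direction j = 0"
  proof (rule ccontr)
    assume "direction j \<noteq> 0"
    then have "t = (of_nat n - of_int l) / of_int (direction j)"
      using n by (simp add: exponent_line_def l field_simps)
    then show False using t by simp
  qed
  then have n_eq_v: "of_int (int n) = v $ j"
    using n by (simp add: exponent_line_def)
  from level j direction_signs consider (i1) "j = i1" | (i3) "j = i3" by fastforce
  then show "B $ j $ 1 \<le> int n"
  proof cases
    case i1
    then have "int n = B $ i1 $ 1 + B $ i1 $ 2 - 1"
      using n_eq_v v_nth(1) by (simp only: of_int_eq_iff)
    then show ?thesis using i1 row1 by simp
  next
    case i3
    then show ?thesis using row3 by simp
  qed
qed

lemma has_descent_irrational:
  assumes t: "t \<notin> \<rat>"
  shows "has_descent A i3 (exponent_line t)"
proof -
  obtain k where k: "\<And>i n. i \<notin> {i1, i2, i3, i4} \<Longrightarrow> exponent_line t $ i = of_nat n \<Longrightarrow>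
      B $ i $ 1 + k * direction i \<le> 0"
  proof (cases "\<exists>i n. i \<notin> {i1, i2, i3, i4} \<and> exponent_line t $ i = of_nat n")
    case True
    then obtain i n where i: "i \<notin> {i1, i2, i3, i4}" "exponent_line t $ i = of_nat n" by blast
    define k where "k = - sgn (direction i) * \<bar>B $ i $ 1\<bar>"
    have "1 * \<bar>B $ i $ 1\<bar> \<le> \<bar>direction i\<bar> * \<bar>B $ i $ 1\<bar>"
      using exponent_line_natural_outside(2)[OF i] by (intro mult_right_mono) auto
    moreover have "k * direction i = - (\<bar>direction i\<bar> * \<bar>B $ i $ 1\<bar>)" by (simp add: k_def abs_sgn)
    ultimately have "B $ i $ 1 + k * direction i \<le> 0" by linarith
    then show thesis using that exponent_line_natural_outside_unique[OF i] by blast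
  qed (use that in blast)
  have shift: "B $ j $ 1 * (1 + k * B $ i3 $ 2) + B $ j $ 2 * (- k * B $ i3 $ 1) =
      B $ j $ 1 + k * direction j" for j
    by (simp add: direction_def algebra_simps)
  show ?thesis
  proof (rule has_descentI[of "1 + k * B $ i3 $ 2" "- k * B $ i3 $ 1"], unfold shift)
    show "B $ i3 $ 1 + k * direction i3 < 0" using row3 direction_signs by simp
    fix j n assume n: "exponent_line t $ j = of_nat n"
    show "B $ j $ 1 + k * direction j \<le> int n"
    proof (cases "j \<in> {i1, i2, i3, i4}")
      case True
      with exponent_line_natural_irrational[OF t _ n] show ?thesis by simp
    next
      case False
      from k[OF this n] show ?thesis by simp
    qed
  qed
qed

subsection \<open>Descents from rational points of the line\<close>

lemma exponent_line_of_real_nth: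
  assumes "exponent_line (of_real r) $ j = of_nat n" "v $ j = of_int l"
  shows "real n = real_of_int l + r * real_of_int (direction j)"
proof -
  have "complex_of_real (real n) = of_real (real_of_int l + r * real_of_int (direction j))"
    using assms by (simp add: exponent_line_def)
  then show ?thesis by (simp only: of_real_eq_iff)
qed

lemma unit_square_level_less_0:
  fixes s1 s2 :: real
  assumes "0 \<le> s1" "0 \<le> s2" "0 < s1 + s2"
  shows "B $ i3 $ 1 * s1 + B $ i3 $ 2 * s2 < 0"
proof -
  have "s1 > 0 \<or> s2 > 0" using assms by linarith
  then have "B $ i3 $ 1 * s1 \<le> 0" "B $ i3 $ 2 * s2 \<le> 0"
    "B $ i3 $ 1 * s1 < 0 \<or> B $ i3 $ 2 * s2 < 0"
    using row3 assms by (auto simp: mult_le_0_iff mult_less_0_iff)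
  then show ?thesis by linarith
qed

lemma unit_square_less_v:
  fixes s1 s2 :: real
  assumes square: "0 \<le> s1" "s1 \<le> 1" "0 \<le> s2" "s2 \<le> 1" "s1 + s2 < 2"
    and v: "v $ j = of_int l" and j: "j \<in> {i1, i2, i4}"
    and corner2: "j = i2 \<Longrightarrow> s1 > 0 \<or> s2 < 1" and corner4: "j = i4 \<Longrightarrow> s1 < 1 \<or> s2 > 0"
  shows "B $ j $ 1 * s1 + B $ j $ 2 * s2 < real_of_int l + 1"
proof -
  from j consider (i1) "j = i1" | (i2) "j = i2" | (i4) "j = i4" by blast
  then show ?thesis
  proof cases
    case i1
    have "s1 < 1 \<or> s2 < 1" using square by linarith
    then have "B $ i1 $ 1 * s1 \<le> B $ i1 $ 1" "B $ i1 $ 2 * s2 \<le> B $ i1 $ 2"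
      "B $ i1 $ 1 * s1 < B $ i1 $ 1 \<or> B $ i1 $ 2 * s2 < B $ i1 $ 2"
      using row1 square by auto
    moreover have "l = B $ i1 $ 1 + B $ i1 $ 2 - 1"
      using v v_nth(1) unfolding i1 by (simp only: of_int_eq_iff)
    ultimately show ?thesis unfolding i1 by auto
  next
    case i2
    then have "B $ i2 $ 1 * s1 \<le> 0" "B $ i2 $ 2 * s2 \<le> B $ i2 $ 2"
      "B $ i2 $ 1 * s1 < 0 \<or> B $ i2 $ 2 * s2 < B $ i2 $ 2"
      using row2 square corner2 by (auto simp: mult_le_0_iff mult_less_0_iff)
    moreover have "l = B $ i2 $ 2 - 1"
      using v v_nth(2) unfolding i2 by (simp only: of_int_eq_iff)
    ultimately show ?thesis unfolding i2 by auto
  next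
    case i4
    then have "B $ i4 $ 1 * s1 \<le> B $ i4 $ 1" "B $ i4 $ 2 * s2 \<le> 0"
      "B $ i4 $ 1 * s1 < B $ i4 $ 1 \<or> B $ i4 $ 2 * s2 < 0"
      using row4 square corner4 by (auto simp: mult_le_0_iff mult_less_0_iff)
    moreover have "l = B $ i4 $ 1 - 1"
      using v v_nth(4) unfolding i4 by (simp only: of_int_eq_iff)
    ultimately show ?thesis unfolding i4 by auto
  qed
qed

text \<open>\<open>(s1, s2)\<close> is the position of the integer point \<open>(z1, z2)\<close> in the unit square translated by
  \<open>r (b\<^sub>3\<^sub>2, - b\<^sub>3\<^sub>1)\<close>, the preimage of \<open>r\<close> times \<open>direction\<close> under \<open>B\<close>.\<close>

lemma has_descent_unit_square:
  fixes r s1 s2 :: real and z1 z2 :: int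
  assumes r: "r \<in> \<rat>"
    and z: "real_of_int z1 = r * B $ i3 $ 2 + s1" "real_of_int z2 = - r * B $ i3 $ 1 + s2"
    and square: "0 \<le> s1" "s1 \<le> 1" "0 \<le> s2" "s2 \<le> 1" "0 < s1 + s2" "s1 + s2 < 2"
    and corner2: "s1 = 0 \<and> s2 = 1 \<Longrightarrow> \<forall>n. exponent_line (of_real r) $ i2 \<noteq> of_nat n"
    and corner4: "s1 = 1 \<and> s2 = 0 \<Longrightarrow> \<forall>n. exponent_line (of_real r) $ i4 \<noteq> of_nat n"
  shows "has_descent A i3 (exponent_line (of_real r))"
proof (rule has_descentI[of z1 z2])
  have Bz: "real_of_int (B $ j $ 1 * z1 + B $ j $ 2 * z2) =
      r * direction j + (B $ j $ 1 * s1 + B $ j $ 2 * s2)" for j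
    by (simp add: z direction_def algebra_simps)
  have "real_of_int (B $ i3 $ 1 * z1 + B $ i3 $ 2 * z2) < 0"
    unfolding Bz direction_signs(3) using unit_square_level_less_0 square by simp
  then show descends: "B $ i3 $ 1 * z1 + B $ i3 $ 2 * z2 < 0" by linarith
  fix j n assume n: "exponent_line (of_real r) $ j = of_nat n"
  have j: "j \<in> {i1, i2, i3, i4}"
    using exponent_line_natural_outside(1)[OF _ n] r by fastforce
  show "B $ j $ 1 * z1 + B $ j $ 2 * z2 \<le> int n"
  proof (cases "j = i3")
    case True
    then show ?thesis using descends by simp
  next
    case False
    obtain l where l: "v $ j = of_int l" using v_integer[OF j] by blast
    have "B $ j $ 1 * s1 + B $ j $ 2 * s2 < real_of_int l + 1"
      using l False j n square corner2 corner4 by (intro unit_square_less_v) force+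
    then show ?thesis
      using exponent_line_of_real_nth[OF n l] Bz[of j] by linarith
  qed
qed

lemma has_descent_lattice_point:
  fixes r :: real
  assumes r: "r \<in> \<rat>" "r \<noteq> 0"
    and z: "real_of_int z1 = r * B $ i3 $ 2" "real_of_int z2 = - r * B $ i3 $ 1"
  shows "has_descent A i3 (exponent_line (of_real r))"
proof -
  have r_direction: "r * real_of_int (direction j) =
      real_of_int (B $ j $ 1 * z1 + B $ j $ 2 * z2)" for j
    by (simp add: z direction_def algebra_simps)
  from \<open>r \<noteq> 0\<close> consider (positive) "r > 0" | (negative) "r < 0" by linarith
  then show ?thesis
  proof cases
    case positive
    then have "real_of_int z1 < 0" "real_of_int z2 > 0"
      unfolding z using row3 by (simp_all add: mult_less_0_iff)
    then have "B $ i4 $ 1 * z1 \<le> B $ i4 $ 1 * (-1)" "B $ i4 $ 2 * z2 \<le> B $ i4 $ 2 * 1"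
      using row4 by (intro mult_left_mono mult_left_mono_neg; simp)+
    then have "exponent_line (of_real r) $ i4 \<noteq> of_nat n" for n
      using exponent_line_of_real_nth[OF _ v_nth(4), of r n] r_direction[of i4] row4 by linarith
    then show ?thesis
      using z by (intro has_descent_unit_square[OF r(1), of "z1 + 1" 1 z2 0]) auto
  next
    case negative
    then have "real_of_int z1 > 0" "real_of_int z2 < 0"
      unfolding z using row3 by (simp_all add: mult_less_0_iff zero_less_mult_iff)
    then have "B $ i2 $ 1 * z1 \<le> B $ i2 $ 1 * 1" "B $ i2 $ 2 * z2 \<le> B $ i2 $ 2 * (-1)"
      using row2 by (intro mult_left_mono mult_left_mono_neg; simp)+
    then have "exponent_line (of_real r) $ i2 \<noteq> of_nat n" for n
      using exponent_line_of_real_nth[OF _ v_nth(2), of r n] r_direction[of i2] row2 by linarith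
    then show ?thesis
      using z by (intro has_descent_unit_square[OF r(1), of z1 0 "z2 + 1" 1]) auto
  qed
qed

lemma has_descent_exponent_line:
  assumes t: "t \<noteq> 0"
  shows "has_descent A i3 (exponent_line t)"
proof (cases "t \<in> \<rat>")
  case True
  then obtain a b :: int where "t = of_int a / of_int b" by (rule Rats_cases')
  then obtain r :: real where t_eq: "t = of_real r"
    by (metis of_real_divide of_real_of_int_eq)
  then have r: "r \<in> \<rat>" "r \<noteq> 0" using True t by auto
  define z1 z2 where "z1 = \<lceil>r * B $ i3 $ 2\<rceil>" and "z2 = \<lceil>- r * B $ i3 $ 1\<rceil>"
  define s1 s2 where "s1 = z1 - r * B $ i3 $ 2" and "s2 = z2 + r * B $ i3 $ 1"
  have s: "0 \<le> s1" "s1 < 1" "0 \<le> s2" "s2 < 1"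
    unfolding s1_def s2_def z1_def z2_def by linarith+
  show ?thesis
    unfolding t_eq
  proof (cases "s1 = 0 \<and> s2 = 0")
    case True
    then show "has_descent A i3 (exponent_line (of_real r))"
      by (intro has_descent_lattice_point[OF r, of z1 z2]) (simp_all add: s1_def s2_def)
  next
    case False
    then have "0 < s1 + s2" using s by linarith
    with s show "has_descent A i3 (exponent_line (of_real r))"
      by (intro has_descent_unit_square[OF r(1), of z1 s1 z2 s2]) (auto simp: s1_def s2_def)
  qed
qed (rule has_descent_irrational)

subsection \<open>The exponent at the origin of the line\<close>

lemma kernel_vector_on_level:
  assumes "z \<noteq> 0" "(B *v z) $ i3 = 0"
  shows "(B *v z) $ i2 \<ge> B $ i2 $ 2 \<or> (B *v z) $ i4 \<ge> B $ i4 $ 1"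
proof -
  have level: "B $ i3 $ 1 * z $ 1 + B $ i3 $ 2 * z $ 2 = 0" using assms(2) by (simp add: B_mult_nth)
  consider (negative) "z $ 1 \<le> -1" | (zero) "z $ 1 = 0" | (positive) "z $ 1 \<ge> 1" by linarith
  then show ?thesis
  proof cases
    case negative
    then have "B $ i3 $ 1 * z $ 1 > 0" using row3 by (simp add: mult_neg_neg)
    then have "B $ i3 $ 2 * z $ 2 < 0" using level by linarith
    then have "z $ 2 > 0" using row3 by (simp add: mult_less_0_iff)
    then have "B $ i2 $ 2 * 1 \<le> B $ i2 $ 2 * z $ 2" "0 \<le> B $ i2 $ 1 * z $ 1"
      using row2 negative by (auto intro: mult_left_mono mult_nonpos_nonpos)
    then show ?thesis by (simp add: B_mult_nth)
  next
    case zero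
    then have "z $ 2 = 0" using level row3 by simp
    then show ?thesis using zero assms(1) by (simp add: vec_eq_iff forall_2)
  next
    case positive
    then have "B $ i3 $ 1 * z $ 1 < 0" using row3 by (simp add: mult_neg_pos)
    then have "B $ i3 $ 2 * z $ 2 > 0" using level by linarith
    then have "z $ 2 < 0" using row3 by (simp add: zero_less_mult_iff)
    then have "B $ i4 $ 1 * 1 \<le> B $ i4 $ 1 * z $ 1" "0 \<le> B $ i4 $ 2 * z $ 2"
      using row4 positive by (auto intro: mult_left_mono mult_nonpos_nonpos)
    then show ?thesis by (simp add: B_mult_nth)
  qed
qed

lemma isolated_exponent_v:
  assumes no_descent: "\<not> has_descent A i3 v"
  shows "isolated_exponent A v"
  unfolding isolated_exponent_def
proof (intro allI impI)
  fix y assume y: "A *v y = 0" "y \<noteq> 0"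
  then obtain z where z: "y = B *v z" "z \<noteq> 0"
    using kernel_eq_range by fastforce
  consider (below) "y $ i3 < 0" | (level) "y $ i3 = 0" | (above) "y $ i3 > 0" by linarith
  then show "\<exists>j n. v $ j = of_nat n \<and> int n < y $ j"
  proof cases
    case below
    then show ?thesis
      using no_descent y(1) unfolding has_descent_def by (meson not_le)
  next
    case level
    have v_i2: "v $ i2 = of_nat (nat (B $ i2 $ 2 - 1))"
      and v_i4: "v $ i4 = of_nat (nat (B $ i4 $ 1 - 1))"
      using row2 row4 v_nth(2,4) by auto
    from level z kernel_vector_on_level
    consider (i2) "B $ i2 $ 2 \<le> y $ i2" | (i4) "B $ i4 $ 1 \<le> y $ i4" by blast
    then show ?thesis
    proof cases
      case i2
      then show ?thesis
        using v_i2 row2 by (intro exI[of _ i2] exI[of _ "nat (B $ i2 $ 2 - 1)"]) simp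
    next
      case i4
      then show ?thesis
        using v_i4 row4 by (intro exI[of _ i4] exI[of _ "nat (B $ i4 $ 1 - 1)"]) simp
    qed
  next
    case above
    then show ?thesis using v_nth(3) by (intro exI[of _ i3] exI[of _ 0]) simp
  qed
qed

lemma v_not_natural_below_column:
  assumes "j \<noteq> i4" "int k < B $ j $ 1"
  shows "v $ j \<noteq> of_nat k"
proof
  assume v: "v $ j = of_nat k"
  then have "j \<in> {i1, i2, i3, i4}"
    using exponent_line_natural_outside(1)[of j 0 k] exponent_line_0 by auto
  then have "j = i1" using assms row2 row3 by auto
  then have "of_int (int k) = (of_int (B $ i1 $ 1 + B $ i1 $ 2 - 1) :: complex)"
    using v v_nth(1) by simp
  then have "int k = B $ i1 $ 1 + B $ i1 $ 2 - 1" by (simp only: of_int_eq_iff)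
  then show False using assms(2) row1 \<open>j = i1\<close> by simp
qed

lemma fake_exponent_iff:
  assumes weight: "admissible_weight A i3 w'"
  shows "fake_exponent A (complex_mat A *v v) w' u \<and> min_neg_support A u \<and> u $ i3 = 0 \<longleftrightarrow>
    u = v \<and> \<not> has_descent A i3 v"
proof
  assume u: "fake_exponent A (complex_mat A *v v) w' u \<and> min_neg_support A u \<and> u $ i3 = 0"
  then have "complex_mat A *v (u - v) = 0" "(u - v) $ i3 = 0"
    using v_nth(3) by (simp_all add: fake_exponent_def matrix_vector_mult_diff_distrib)
  then obtain t where "\<And>j. (u - v) $ j = t * of_int (direction j)"
    using complex_kernel_vector_level by blast
  then have "u $ j = exponent_line t $ j" for j
    by (simp add: exponent_line_def diff_eq_eq add.commute)
  then have line: "u = exponent_line t" by (simp add: vec_eq_iff)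
  moreover have "\<not> has_descent A i3 u"
    using fake_exponent_imp_no_descent[OF weight] u by blast
  ultimately have "t = 0" using has_descent_exponent_line by blast
  then show "u = v \<and> \<not> has_descent A i3 v"
    using line \<open>\<not> has_descent A i3 u\<close> exponent_line_0 by simp
next
  assume "u = v \<and> \<not> has_descent A i3 v"
  then show "fake_exponent A (complex_mat A *v v) w' u \<and> min_neg_support A u \<and> u $ i3 = 0"
    using isolated_exponent_imp_fake_exponent isolated_exponent_imp_min_neg_support
      isolated_exponent_v v_nth(3) by blast
qed

section \<open>The kernel of the derivation\<close>

lemma cmonomial_on_in_kernel:
  assumes no_descent: "\<not> has_descent A i3 v" and U: "open U" and L: "log_branches U L"
  shows "cmonomial_on U L v \<in> solutions U (hypergeometric_ideal A (complex_mat A *v v))"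
    and "cpartial_on U i3 (cmonomial_on U L v) = 0"
proof -
  show "cmonomial_on U L v \<in> solutions U (hypergeometric_ideal A (complex_mat A *v v))"
    unfolding solutions_hypergeometric_ideal_iff[OF U]
    using holomorphic_sev_on_cmonomial_on[OF L U] euler_solution_cmonomial_on[OF L U]
      isolated_exponent_imp_toric_solution[OF isolated_exponent_v[OF no_descent] L U]
    by (simp add: cmonomial_on_def)
  have "cpartial i3 (cmonomial_on U L v) x = 0" if "x \<in> U" for x
    using has_cgradient_imp_cpartial[OF has_cgradient_cmonomial_on[OF L U that]] v_nth(3) by simp
  then show "cpartial_on U i3 (cmonomial_on U L v) = 0"
    by (simp add: cpartial_on_def fun_eq_iff)
qed

context
  fixes U :: "(complex ^ 'n) set" and L \<psi>
  assumes U: "open U" and L: "log_branches U L"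
    and solution: "\<psi> \<in> solutions U (hypergeometric_ideal A (complex_mat A *v v))"
    and kernel: "cpartial_on U i3 \<psi> = 0"
begin

lemma \<psi>_holomorphic: "holomorphic_sev_on \<psi> U" and \<psi>_outside: "x \<notin> U \<Longrightarrow> \<psi> x = 0"
  and \<psi>_toric: "toric_solution U A \<psi>" and \<psi>_euler: "euler_solution U A (complex_mat A *v v) \<psi>"
  using solution unfolding solutions_hypergeometric_ideal_iff[OF U] by blast+

lemma \<psi>_independent: "x \<in> U \<Longrightarrow> cpartial i3 \<psi> x = 0"
  using fun_cong[OF kernel, of x] by (simp add: cpartial_on_def)

interpretation log_line U \<psi> v "\<lambda>j. of_int (direction j)" i2
proof
  fix x assume x: "x \<in> U"
  define y where "y = (\<chi> j. log_partial j \<psi> x) - \<psi> x *s v"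
  have "complex_mat A *v (\<psi> x *s v) = \<psi> x *s (complex_mat A *v v)"
    by (simp add: vector_scalar_commute)
  then have "complex_mat A *v y = 0"
    using \<psi>_euler x by (simp add: y_def matrix_vector_mult_diff_distrib euler_solution_def)
  moreover have "y $ i3 = 0"
    using \<psi>_independent[OF x] v_nth(3) by (simp add: y_def log_partial_def)
  ultimately obtain s where "\<And>j. y $ j = s * of_int (direction j)"
    using complex_kernel_vector_level by blast
  then have "log_partial j \<psi> x = v $ j * \<psi> x + of_int (direction j) * s" for j
    by (simp add: y_def diff_eq_eq algebra_simps)
  then show "\<exists>s. \<forall>j. log_partial j \<psi> x = v $ j * \<psi> x + of_int (direction j) * s" by blast
qed (use U \<psi>_holomorphic direction_signs in simp_all)

lemma nonroot_if_has_descent_exponent_line: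
  "has_descent A i3 (exponent_line s) \<Longrightarrow> \<exists>p\<in>annihilator. poly p s \<noteq> 0"
  using nonroot_if_has_descent[OF \<psi>_toric \<psi>_independent] by (simp add: exponent_line_def)

lemma kernel_zero_if_has_descent:
  assumes "has_descent A i3 v"
  shows "\<psi> = 0"
proof -
  have "has_descent A i3 (exponent_line s)" for s
    using assms has_descent_exponent_line exponent_line_0 by (cases "s = 0") simp_all
  then have "\<psi> x = 0" for x
    using zero_if_no_common_root[OF nonroot_if_has_descent_exponent_line] \<psi>_outside by blast
  then show ?thesis by (simp add: fun_eq_iff)
qed

lemma annihilator_has_simple_root: "\<exists>r. pCons 0 r \<in> annihilator \<and> poly r 0 \<noteq> 0"
proof -
  define u where "u = (\<chi> j. nat (B $ j $ 1)) - axis i4 1"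
  have u: "u + axis i4 1 = (\<chi> j. nat (B $ j $ 1))"
    using row4 by (auto simp: u_def vec_eq_iff axis_def)
  have v_i4: "v $ i4 = of_nat (u $ i4)"
    using row4 v_nth(4) by (simp add: u_def)
  have "(\<chi> j. B $ j $ 1) = B *v axis 1 1"
    by (simp add: vec_eq_iff B_mult_nth axis_def)
  then have "A *v (\<chi> j. B $ j $ 1) = 0"
    using kernel_eq_range by blast
  then have "indicial (u + axis i4 1) \<in> annihilator"
    using row3 indicial_in_annihilator toric_solution_pos_part_annihilates[OF
        \<psi>_holomorphic U \<psi>_toric \<psi>_independent, of "\<chi> j. B $ j $ 1"]
    unfolding u by simp
  then have "pCons 0 (smult (of_int (direction i4)) (indicial u)) \<in> annihilator"
    by (simp only: indicial_add_axis[OF v_i4])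
  moreover have "v $ j \<noteq> of_nat k" if "k < u $ j" for j k
  proof (cases "j = i4")
    case False
    then show ?thesis using that by (intro v_not_natural_below_column) (simp_all add: u_def)
  qed (use that v_i4 in simp)
  then have "poly (smult (of_int (direction i4)) (indicial u)) 0 \<noteq> 0"
    using direction_signs by (auto simp: poly_indicial falling_fact_eq_0_iff)
  ultimately show ?thesis by blast
qed

lemma kernel_subset_multiples_cmonomial_on:
  assumes "connected U" "U \<noteq> {}"
  shows "\<psi> \<in> range (\<lambda>c. fun_scale c (cmonomial_on U L v))"
proof -
  obtain r where "pCons 0 r \<in> annihilator" "poly r 0 \<noteq> 0" using annihilator_has_simple_root by blast
  then have "log_partial j \<psi> x = v $ j * \<psi> x" if "x \<in> U" for j x
    using homogeneous_if_simple_common_root[OF nonroot_if_has_descent_exponent_line]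
      has_descent_exponent_line that
    by blast
  then show ?thesis
    using homogeneous_imp_multiple_cmonomial_on[OF L U assms \<psi>_holomorphic \<psi>_outside] by blast
qed

end

end

theorem theorem4p2:
  fixes A :: "int ^ 'n::finite ^ 'd::finite"
    and B :: "int ^ 2 ^ 'n"
    and r0 :: 'd
    and i1 i2 i3 i4 :: 'n
    and \<alpha> :: "'n \<Rightarrow> complex"
    and v :: "complex ^ 'n"
    and \<beta> :: "complex ^ 'd"
    and w' :: "real ^ 'n"
    and U :: "(complex ^ 'n) set"
    and L :: "'n \<Rightarrow> complex ^ 'n \<Rightarrow> complex"
  assumes codim: "CARD('n) = CARD('d) + 2"
    and rank_A: "rank (real_mat A) = CARD('d)"
    and first_row: "\<And>j. A $ r0 $ j = 1"
    and span_A: "\<And>y :: int ^ 'd. \<exists>u :: int ^ 'n. A *v u = y"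
    and basis_B: "bij_betw (\<lambda>z :: int ^ 2. B *v z) UNIV {u. A *v u = 0}"
    and idx: "distinct [i1, i2, i3, i4]"
    and row1: "B $ i1 $ 1 > 0" "B $ i1 $ 2 > 0"
    and row2: "B $ i2 $ 1 < 0" "B $ i2 $ 2 > 0"
    and row3: "B $ i3 $ 1 < 0" "B $ i3 $ 2 < 0"
    and row4: "B $ i4 $ 1 > 0" "B $ i4 $ 2 < 0"
    and quadrant: "independent {row i2 (real_mat B), row i4 (real_mat B)} \<Longrightarrow>
      {z :: real ^ 2. (real_mat B *v z) $ i2 \<ge> 0 \<and> (real_mat B *v z) $ i4 \<ge> 0}
        \<subseteq> {z. z $ 1 \<ge> 0 \<and> z $ 2 \<ge> 0}"
    and \<alpha>_irrational: "\<And>i. i \<notin> {i1, i2, i3, i4} \<Longrightarrow> \<alpha> i \<notin> \<rat>"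
    and \<alpha>_generic: "\<And>i. i \<notin> {i1, i2, i3, i4} \<Longrightarrow>
      \<alpha> i \<notin> rat_adjoin (\<alpha> ` (UNIV - {i1, i2, i3, i4, i}))"
    and v_def: "v = complex_vec (pos_part (column 1 B) + pos_part (column 2 B))
      - axis i1 1 - axis i2 1 - axis i4 1 + (\<Sum>i \<in> UNIV - {i1, i2, i3, i4}. axis i (\<alpha> i))"
    and \<beta>_def: "\<beta> = complex_mat A *v (v - axis i3 1)"
    and weight: "admissible_weight A i3 w'"
    and U: "open U" "connected U" "U \<noteq> {}"
    and L: "log_branches U L"
  shows "linear_map_between
           (solutions U (hypergeometric_ideal A (complex_mat A *v v)))
           (solutions U (hypergeometric_ideal A \<beta>))
           (cpartial_on U i3)
       \<and> {\<psi> \<in> solutions U (hypergeometric_ideal A (complex_mat A *v v)). cpartial_on U i3 \<psi> = 0}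
         = fun_span {cmonomial_on U L u | u.
             fake_exponent A (complex_mat A *v v) w' u \<and> min_neg_support A u \<and> u $ i3 = 0}"
    (is "linear_map_between ?S _ _ \<and> ?K = fun_span ?X")
proof -
  interpret gale_dual A B i1 i2 i3 i4 \<alpha> v
    by unfold_locales (fact assms)+
  interpret fun_module: module "fun_scale :: complex \<Rightarrow> (complex ^ 'n \<Rightarrow> complex) \<Rightarrow> _"
    by (rule module_fun_scale)
  have linear: "linear_map_between ?S (solutions U (hypergeometric_ideal A \<beta>)) (cpartial_on U i3)"
    unfolding \<beta>_def matrix_vector_mult_diff_distrib
    by (rule linear_map_between_cpartial_on[OF U(1)])
  have X: "?X = (if has_descent A i3 v then {} else {cmonomial_on U L v})"
    unfolding fake_exponent_iff[OF weight] by auto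
  have "fun_module.subspace ?K"
    by (rule subspace_kernel_linear_map_between[OF subspace_solutions[OF U(1)] linear])
  moreover have "?X \<subseteq> ?K"
    using cmonomial_on_in_kernel[OF _ U(1) L] by (simp add: X)
  ultimately have "fun_span ?X \<subseteq> ?K"
    unfolding fun_span_def by (rule fun_module.span_minimal[rotated])
  moreover have "?K \<subseteq> fun_span ?X"
    using kernel_zero_if_has_descent[OF U(1) L]
      kernel_subset_multiples_cmonomial_on[OF U(1) L _ _ U(2,3)]
    by (auto simp: X fun_span_def fun_module.span_singleton)
  ultimately show ?thesis using linear by blast
qed

end
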